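(* For every $n>3$ there exists a vertex-faithful simplicial sphere $X_{D_n}$ whose face graph is (isomorphic to) $\Gamma_{D_n}$ and whose automorphism group is isomorphic to the dihedral group $D_n$ of order $2n$. Furthermore, the graph $\Gamma_{D_n}$ is a $3$-connected planar cubic graph.
   Context: The graph $\Gamma_{D_n}$ has the $4n$ nodes $a_i,b_i,c_i,d_i$ ($i=1,\dots,n$) and the edges $\{a_i,b_i\}$, $\{a_i,c_i\}$, $\{c_i,d_i\}$, $\{b_i,c_i\}$ for $i=1,\dots,n$, together with $\{a_j,b_{j+1}\}$ and $\{d_j,d_{j+1}\}$ for $j=1,\dots,n-1$, and $\{a_n,b_1\}$ and $\{d_1,d_n\}$. A (closed) simplicial surface $(X,<)$ is a countable set $X$ partitioned into non-empty sets $X_0$ (vertices), $X_1$ (edges), $X_2$ (faces), together with a relation $<$ (incidence), a subset of $(X_0\times X_1)\cup(X_1\times X_2)\cup(X_0\times X_2)$, such that: (1) for each edge $e\in X_1$ there are exactly two vertices $V\in X_0$ with $V<e$; (2) for each face $F\in X_2$ there are exactly three edges $e\in X_1$ with $e<F$ and exactly three vertices $V\in X_0$ with $V<F$, and each of these three vertices is incident to exactly two of these three edges; (3) for each edge $e\in X_1$ there are exactly two faces $F\in X_2$ with $e<F$; (4) (umbrella condition) for each vertex $V\in X_0$ the number $m=\deg(V)$ of faces $F\in X_2$ with $V<F$ satisfies $3\le \deg(V)<\infty$, and these faces can be arranged in a sequence $(F_1,\dots,F_m)$ such that, with $F_{m+1}=F_1$, the faces $F_i$ and $F_{i+1}$ share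 a common edge $e_i$ with $V<e_i$ for $i=1,\dots,m$. A homomorphism $\pi:X\to Y$ of simplicial surfaces is a map such that $A<_X B$ implies $\pi(A)<_Y\pi(B)$, and such that for every face $F$ the restriction of $\pi$ to the vertices and edges incident to $F$ is an isomorphism onto the set of vertices and edges incident to $\pi(F)$. $\mathrm{Aut}(X)$ is the group of automorphisms of $X$, i.e. invertible homomorphisms $X\to X$ (equivalently, permutations of $X$ preserving each of $X_0,X_1,X_2$ and preserving the incidence relation in both directions). $X$ is vertex-faithful if the map $X\to\mathcal{P}(X_0)$, $x\mapsto\{V\in X_0\mid V<x\text{ or }V=x\}$, is injective. A simplicial sphere is a connected finite simplicial surface with Euler characteristic $\chi(X)=|X_0|-|X_1|+|X_2|=2$. The face graph $\mathcal{F}(X)$ has node set $X_2$ and edge set $X_1$, where $e\in X_1$ connects the two faces $F$ with $e<F$. *)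

theory Defs
  imports "HOL-Algebra.Bij" "HOL-Analysis.Path_Connected" "HOL-Library.Countable_Set"
begin

section \<open>Simplicial surfaces\<close>

record 'a surface =
  vertices :: "'a set"
  edges :: "'a set"
  faces :: "'a set"
  incident :: "'a \<Rightarrow> 'a \<Rightarrow> bool" (infix \<open>\<triangleleft>\<index>\<close> 50)

definition elements :: "('a, 'z) surface_scheme \<Rightarrow> 'a set" where
  "elements X = vertices X \<union> edges X \<union> faces X"

locale simplicial_surface =
  fixes X (structure)
  assumes countable_elements: "countable (elements X)"
    and nonempty: "vertices X \<noteq> {}" "edges X \<noteq> {}" "faces X \<noteq> {}"
    and disjoint: "vertices X \<inter> edges X = {}" "vertices X \<inter> faces X = {}" "edges X \<inter> faces X = {}"
    and incident_in: "A \<triangleleft> B \<Longrightarrow>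
      (A, B) \<in> (vertices X \<times> edges X) \<union> (edges X \<times> faces X) \<union> (vertices X \<times> faces X)"
    and edge_vertices: "e \<in> edges X \<Longrightarrow> card {V \<in> vertices X. V \<triangleleft> e} = 2"
    and face_edges: "F \<in> faces X \<Longrightarrow> card {e \<in> edges X. e \<triangleleft> F} = 3"
    and face_vertices: "F \<in> faces X \<Longrightarrow> card {V \<in> vertices X. V \<triangleleft> F} = 3"
    and face_vertex_edges: "F \<in> faces X \<Longrightarrow> V \<in> vertices X \<Longrightarrow> V \<triangleleft> F \<Longrightarrow>
      card {e \<in> edges X. e \<triangleleft> F \<and> V \<triangleleft> e} = 2"
    and edge_faces: "e \<in> edges X \<Longrightarrow> card {F \<in> faces X. e \<triangleleft> F} = 2"
    and finite_degree: "V \<in> vertices X \<Longrightarrow> finite {F \<in> faces X. V \<triangleleft> F}"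
    and degree_ge_3: "V \<in> vertices X \<Longrightarrow> 3 \<le> card {F \<in> faces X. V \<triangleleft> F}"
    and umbrella: "V \<in> vertices X \<Longrightarrow>
      \<exists>Fs. distinct Fs \<and> set Fs = {F \<in> faces X. V \<triangleleft> F} \<and>
        (\<forall>i < length Fs. \<exists>e \<in> edges X.
           V \<triangleleft> e \<and> e \<triangleleft> Fs ! i \<and> e \<triangleleft> Fs ! (Suc i mod length Fs))"

definition boundary :: "('a, 'z) surface_scheme \<Rightarrow> 'a \<Rightarrow> 'a set" where
  "boundary X F = {A \<in> vertices X \<union> edges X. A \<triangleleft>\<^bsub>X\<^esub> F}"

definition surface_hom ::
    "('a, 'y) surface_scheme \<Rightarrow> ('b, 'z) surface_scheme \<Rightarrow> ('a \<Rightarrow> 'b) set" where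
  "surface_hom X Y = {\<pi> \<in> elements X \<rightarrow> elements Y.
     (\<forall>A \<in> elements X. \<forall>B \<in> elements X. A \<triangleleft>\<^bsub>X\<^esub> B \<longrightarrow> \<pi> A \<triangleleft>\<^bsub>Y\<^esub> \<pi> B) \<and>
     (\<forall>F \<in> faces X. bij_betw \<pi> (boundary X F) (boundary Y (\<pi> F)) \<and>
        (\<forall>A \<in> boundary X F. \<forall>B \<in> boundary X F. A \<triangleleft>\<^bsub>X\<^esub> B \<longleftrightarrow> \<pi> A \<triangleleft>\<^bsub>Y\<^esub> \<pi> B))}"

text \<open>As in \<^const>\<open>BijGroup\<close>, automorphisms are \<^const>\<open>undefined\<close> outside \<open>elements X\<close>, so that
  they are determined by their values on the surface.\<close>

definition Aut :: "('a, 'z) surface_scheme \<Rightarrow> ('a \<Rightarrow> 'a) monoid" where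
  "Aut X = BijGroup (elements X)
     \<lparr>carrier := {\<pi> \<in> Bij (elements X).
        \<pi> \<in> surface_hom X X \<and> inv_into (elements X) \<pi> \<in> surface_hom X X}\<rparr>"

definition vertex_faithful :: "('a, 'z) surface_scheme \<Rightarrow> bool" where
  "vertex_faithful X \<longleftrightarrow>
     inj_on (\<lambda>x. {V \<in> vertices X. V \<triangleleft>\<^bsub>X\<^esub> x \<or> V = x}) (elements X)"

text \<open>Connectedness: any two elements are joined by a chain of incidences (read in either
  direction).\<close>

definition surface_connected :: "('a, 'z) surface_scheme \<Rightarrow> bool" where
  "surface_connected X \<longleftrightarrow> (\<forall>A \<in> elements X. \<forall>B \<in> elements X.
     (A, B) \<in> {(C, D). C \<triangleleft>\<^bsub>X\<^esub> D \<or> D \<triangleleft>\<^bsub>X\<^esub> C}\<^sup>*)"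

definition euler_characteristic :: "('a, 'z) surface_scheme \<Rightarrow> int" where
  "euler_characteristic X =
     int (card (vertices X)) - int (card (edges X)) + int (card (faces X))"

definition simplicial_sphere :: "('a, 'z) surface_scheme \<Rightarrow> bool" where
  "simplicial_sphere X \<longleftrightarrow> simplicial_surface X \<and> finite (elements X) \<and>
     surface_connected X \<and> euler_characteristic X = 2"


section \<open>Graphs\<close>

text \<open>Undirected graphs without loops; distinct edges may have the same end nodes, since the
  edges of a face graph are the edges of the surface.\<close>

record ('v, 'e) ugraph =
  nodes :: "'v set"
  links :: "'e set"
  ends :: "'e \<Rightarrow> 'v set"

definition graph :: "('v, 'e, 'z) ugraph_scheme \<Rightarrow> bool" where
  "graph G \<longleftrightarrow> (\<forall>e \<in> links G. ends G e \<subseteq> nodes G \<and> card (ends G e) = 2)"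

definition graph_iso :: "('v, 'e, 'y) ugraph_scheme \<Rightarrow> ('w, 'f, 'z) ugraph_scheme \<Rightarrow> bool" where
  "graph_iso G H \<longleftrightarrow> (\<exists>\<phi> \<psi>. bij_betw \<phi> (nodes G) (nodes H) \<and> bij_betw \<psi> (links G) (links H) \<and>
     (\<forall>e \<in> links G. ends H (\<psi> e) = \<phi> ` ends G e))"

definition cubic :: "('v, 'e, 'z) ugraph_scheme \<Rightarrow> bool" where
  "cubic G \<longleftrightarrow> (\<forall>v \<in> nodes G. card {e \<in> links G. v \<in> ends G e} = 3)"

definition graph_connected :: "('v, 'e, 'z) ugraph_scheme \<Rightarrow> bool" where
  "graph_connected G \<longleftrightarrow>
     (\<forall>u \<in> nodes G. \<forall>v \<in> nodes G. (u, v) \<in> {(x, y). \<exists>e \<in> links G. ends G e = {x, y}}\<^sup>*)"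

definition delete_nodes :: "('v, 'e) ugraph \<Rightarrow> 'v set \<Rightarrow> ('v, 'e) ugraph" where
  "delete_nodes G S =
     \<lparr>nodes = nodes G - S, links = {e \<in> links G. ends G e \<inter> S = {}}, ends = ends G\<rparr>"

definition k_connected :: "nat \<Rightarrow> ('v, 'e) ugraph \<Rightarrow> bool" where
  "k_connected k G \<longleftrightarrow> (finite (nodes G) \<longrightarrow> k < card (nodes G)) \<and>
     (\<forall>S \<subseteq> nodes G. finite S \<and> card S < k \<longrightarrow> graph_connected (delete_nodes G S))"

text \<open>A drawing in the plane: nodes are distinct points, each edge is a simple arc joining its
  end nodes and avoiding all other nodes, and arcs of distinct edges meet only in the common end
  nodes of these edges.\<close>

definition planar :: "('v, 'e, 'z) ugraph_scheme \<Rightarrow> bool" where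
  "planar G \<longleftrightarrow> (\<exists>(p :: 'v \<Rightarrow> complex) (\<gamma> :: 'e \<Rightarrow> real \<Rightarrow> complex).
     inj_on p (nodes G) \<and>
     (\<forall>e \<in> links G. arc (\<gamma> e) \<and> {pathstart (\<gamma> e), pathfinish (\<gamma> e)} = p ` ends G e \<and>
        path_image (\<gamma> e) \<inter> p ` nodes G = p ` ends G e) \<and>
     (\<forall>e \<in> links G. \<forall>f \<in> links G. e \<noteq> f \<longrightarrow>
        path_image (\<gamma> e) \<inter> path_image (\<gamma> f) = p ` (ends G e \<inter> ends G f)))"

definition face_graph :: "('a, 'z) surface_scheme \<Rightarrow> ('a, 'a) ugraph" where
  "face_graph X =
     \<lparr>nodes = faces X, links = edges X, ends = (\<lambda>e. {F \<in> faces X. e \<triangleleft>\<^bsub>X\<^esub> F})\<rparr>"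

datatype gamma_node = av nat | bv nat | cv nat | dv nat

definition Gamma_D :: "nat \<Rightarrow> (gamma_node, gamma_node set) ugraph" where
  "Gamma_D n =
     \<lparr>nodes = (\<Union>i \<in> {1..n}. {av i, bv i, cv i, dv i}),
      links = (\<Union>i \<in> {1..n}. {{av i, bv i}, {av i, cv i}, {cv i, dv i}, {bv i, cv i}})
        \<union> (\<Union>j \<in> {1..n - 1}. {{av j, bv (j + 1)}, {dv j, dv (j + 1)}})
        \<union> {{av n, bv 1}, {dv 1, dv n}},
      ends = (\<lambda>e. e)\<rparr>"


section \<open>The dihedral group of order \<open>2 * n\<close>\<close>

text \<open>The pair \<open>(i, s)\<close> stands for \<open>r\<^sup>i\<close> if \<open>s\<close> is false and for \<open>r\<^sup>i t\<close> if \<open>s\<close> is true, where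
  \<open>r\<close> is the rotation of order \<open>n\<close> and \<open>t\<close> a reflection, so \<open>t r t = r\<^sup>-\<^sup>1\<close>.\<close>

definition dihedral_group :: "nat \<Rightarrow> (int \<times> bool) monoid" where
  "dihedral_group n =
     \<lparr>carrier = {0..<int n} \<times> UNIV,
      monoid.mult = (\<lambda>(i, s) (j, t). ((if s then i - j else i + j) mod int n, s \<noteq> t)),
      one = (0, False)\<rparr>"

end

theory Submission
  imports Defs
begin

text \<open>The surface is built from its face graph by duality. The graph \<open>\<Gamma>\<^sub>D\<close> is the prism over an \<open>n\<close>-gon in which
  the \<open>n\<close> nodes of one of the two rings have been replaced by triangles \<open>a\<^sub>i b\<^sub>i c\<^sub>i\<close>. It has a plane drawing with
  \<open>2 n + 2\<close> regions, and the dual triangulation is the double pyramid over an \<open>n\<close>-gon whose lower faces are each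
  subdivided by one more vertex. Its faces are given by \<open>triangle\<close>, indexed by the nodes of
  \<open>\<Gamma>\<^sub>D\<close>. The surface axioms reduce to two facts about these triangles: each edge lies in exactly two of
  them, which form a link of the graph (\<open>star_pair\<close>), and those around a vertex form a cycle
  (\<open>umbrella_D\<close>). There are \<open>4 n\<close> triangles and \<open>2 n + 2\<close> vertices, so the Euler characteristic is 2.

  Automorphisms of such a surface are the same as vertex permutations that map triangles to triangles
  (\<open>Aut_induced\<close>). Rotations and reflections of the \<open>n\<close>-gon are of this kind. There
  are no others, because for \<open>n > 3\<close> the kinds of vertices can be told apart by their degrees and their
  neighbours, so that a permutation acts on the \<open>n\<close>-gon preserving adjacency, and this
  action determines it (\<open>rigidity\<close>).

  The graph is 3-connected because neighbouring columns \<open>{a\<^sub>i, b\<^sub>i, c\<^sub>i, d\<^sub>i}\<close> form a 2-connected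
  graph, columns are arranged in a ring, and each node has three disjoint paths out of its column
  (\<open>k_connected_Gamma\<close>). It is planar by an explicit drawing in a strip, which is checked by
  labelling the points of the plane (\<open>planar_by_labelling\<close>).\<close>

section \<open>The graph as a ring of columns\<close>

definition nxt :: "nat \<Rightarrow> nat \<Rightarrow> nat" where
  "nxt n k = (if k = n then 1 else k + 1)"

definition prv :: "nat \<Rightarrow> nat \<Rightarrow> nat" where
  "prv n k = (if k = 1 then n else k - 1)"

lemma nxt_mem [simp]: "k \<in> {1..n} \<Longrightarrow> nxt n k \<in> {1..n}"
  by (auto simp: nxt_def)

lemma prv_mem [simp]: "k \<in> {1..n} \<Longrightarrow> prv n k \<in> {1..n}"
  by (auto simp: prv_def)

lemma nxt_prv [simp]: "k \<in> {1..n} \<Longrightarrow> nxt n (prv n k) = k"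
  by (auto simp: nxt_def prv_def)

lemma prv_nxt [simp]: "k \<in> {1..n} \<Longrightarrow> prv n (nxt n k) = k"
  by (auto simp: nxt_def prv_def)

lemma nxt_nxt_neq: "\<lbrakk>n > 2; k \<in> {1..n}\<rbrakk> \<Longrightarrow> nxt n (nxt n k) \<noteq> k"
  by (auto simp: nxt_def split: if_splits)

lemma nxt_neq: "\<lbrakk>n > 1; k \<in> {1..n}\<rbrakk> \<Longrightarrow> nxt n k \<noteq> k"
  by (auto simp: nxt_def split: if_splits)

lemma prv_neq: "\<lbrakk>n > 1; k \<in> {1..n}\<rbrakk> \<Longrightarrow> prv n k \<noteq> k"
  by (auto simp: prv_def split: if_splits)

lemma prv_neq_nxt: "\<lbrakk>n > 2; k \<in> {1..n}\<rbrakk> \<Longrightarrow> prv n k \<noteq> nxt n k"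
  by (auto simp: nxt_def prv_def split: if_splits)

text \<open>Removing \<open>j\<close> from the cycle \<open>1, \<dots>, n\<close> leaves a path that starts at the successor of \<open>j\<close>. The proof
  follows it in two pieces, from \<open>j + 1\<close> up to \<open>n\<close> and from \<open>1\<close> up to \<open>j - 1\<close>.\<close>

lemma cycle_walk_induct:
  assumes j: "j \<in> {1..n}" and start: "nxt n j \<noteq> j \<Longrightarrow> P (nxt n j)"
    and step: "\<And>i. \<lbrakk>i \<in> {1..n}; i \<noteq> j; nxt n i \<noteq> j; P i\<rbrakk> \<Longrightarrow> P (nxt n i)"
    and k: "k \<in> {1..n}" "k \<noteq> j"
  shows "P k"
proof -
  have up: "P (j + m)" if "1 \<le> m" "j + m \<le> n" for m
    using that
  proof (induction m rule: dec_induct)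
    case base
    then show ?case using start by (auto simp: nxt_def split: if_splits)
  next
    case (step m)
    then show ?case using assms(3)[of "j + m"] j by (auto simp: nxt_def split: if_splits)
  qed
  have one: "P 1" if "1 < j"
  proof (cases "j = n")
    case True
    then show ?thesis using start that by (auto simp: nxt_def split: if_splits)
  next
    case False
    then have "P n" using up[of "n - j"] j by auto
    then show ?thesis using step[of n] False j that by (auto simp: nxt_def split: if_splits)
  qed
  have low: "P m" if "1 \<le> m" "m < j" for m
    using that
  proof (induction m rule: dec_induct)
    case base
    then show ?case using one by auto
  next
    case (step m)
    then show ?case using assms(3)[of m] j by (auto simp: nxt_def split: if_splits)
  qed
  show ?thesis
    using up[of "k - j"] low[of k] k by (cases "k < j") auto
qed

lemma nodes_Gamma: "nodes (Gamma_D n) = av ` {1..n} \<union> bv ` {1..n} \<union> cv ` {1..n} \<union> dv ` {1..n}"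
  by (auto simp: Gamma_D_def)

lemma ends_Gamma [simp]: "ends (Gamma_D n) e = e"
  by (simp add: Gamma_D_def)

text \<open>The two edges \<open>{a\<^sub>n, b\<^sub>1}\<close> and \<open>{d\<^sub>1, d\<^sub>n}\<close> that close the rings are the edges to the next column
  for \<open>k = n\<close>, so all columns can be treated alike.\<close>

definition column_links :: "nat \<Rightarrow> nat \<Rightarrow> gamma_node set set" where
  "column_links n k = {{av k, bv k}, {av k, cv k}, {cv k, dv k}, {bv k, cv k},
     {av k, bv (nxt n k)}, {dv k, dv (nxt n k)}}"

lemma links_Gamma:
  assumes "n \<ge> 1"
  shows "links (Gamma_D n) = (\<Union>k \<in> {1..n}. column_links n k)"
proof -
  have split: "{1..n} = insert n {1..n - 1}" using assms by auto
  have "(\<Union>j \<in> {1..n - 1}. {{av j, bv (j + 1)}, {dv j, dv (j + 1)}}) =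
        (\<Union>j \<in> {1..n - 1}. {{av j, bv (nxt n j)}, {dv j, dv (nxt n j)}})"
    using assms by (intro SUP_cong) (auto simp: nxt_def)
  moreover have "{{av n, bv 1}, {dv 1, dv n}} = {{av n, bv (nxt n n)}, {dv n, dv (nxt n n)}}"
    by (auto simp: nxt_def)
  ultimately have "(\<Union>j \<in> {1..n - 1}. {{av j, bv (j + 1)}, {dv j, dv (j + 1)}}) \<union> {{av n, bv 1}, {dv 1, dv n}} =
        (\<Union>j \<in> {1..n}. {{av j, bv (nxt n j)}, {dv j, dv (nxt n j)}})"
    by (subst split) auto
  moreover have "(\<Union>i \<in> {1..n}. column_links n i) = (\<Union>i \<in> {1..n}. {{av i, bv i}, {av i, cv i}, {cv i, dv i}, {bv i, cv i}}) \<union>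
      (\<Union>j \<in> {1..n}. {{av j, bv (nxt n j)}, {dv j, dv (nxt n j)}})"
    by (auto simp: column_links_def)
  ultimately show ?thesis
    unfolding Gamma_D_def by (simp only: ugraph.simps Un_assoc)
qed

lemma link_cases [consumes 2, case_names ab ac cd bc a_next d_next]:
  assumes "e \<in> links (Gamma_D n)" "n \<ge> 1"
  obtains k where "k \<in> {1..n}" "e = {av k, bv k}" | k where "k \<in> {1..n}" "e = {av k, cv k}"
    | k where "k \<in> {1..n}" "e = {cv k, dv k}" | k where "k \<in> {1..n}" "e = {bv k, cv k}"
    | k where "k \<in> {1..n}" "e = {av k, bv (nxt n k)}" | k where "k \<in> {1..n}" "e = {dv k, dv (nxt n k)}"
proof -
  obtain k where k: "k \<in> {1..n}" "e \<in> column_links n k" using assms by (auto simp: links_Gamma)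
  from k(2) show thesis
    unfolding column_links_def insert_iff empty_iff using that[OF k(1)] by satx
qed

lemma link_mem:
  assumes "k \<in> {1..n}"
  shows "{av k, bv k} \<in> links (Gamma_D n)" "{av k, cv k} \<in> links (Gamma_D n)"
    "{cv k, dv k} \<in> links (Gamma_D n)" "{bv k, cv k} \<in> links (Gamma_D n)"
    "{av k, bv (nxt n k)} \<in> links (Gamma_D n)" "{dv k, dv (nxt n k)} \<in> links (Gamma_D n)"
proof -
  have "column_links n k \<subseteq> links (Gamma_D n)"
    using assms by (subst links_Gamma) auto
  then show "{av k, bv k} \<in> links (Gamma_D n)" "{av k, cv k} \<in> links (Gamma_D n)"
    "{cv k, dv k} \<in> links (Gamma_D n)" "{bv k, cv k} \<in> links (Gamma_D n)"
    "{av k, bv (nxt n k)} \<in> links (Gamma_D n)" "{dv k, dv (nxt n k)} \<in> links (Gamma_D n)"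
    unfolding column_links_def by (simp_all only: insert_subset)
qed

lemma graph_Gamma:
  assumes "n > 1"
  shows "graph (Gamma_D n)"
  unfolding graph_def
proof
  fix e assume "e \<in> links (Gamma_D n)"
  moreover have "n \<ge> 1" using assms by simp
  ultimately show "ends (Gamma_D n) e \<subseteq> nodes (Gamma_D n) \<and> card (ends (Gamma_D n) e) = 2"
    using nxt_neq[OF assms, symmetric] nxt_mem[of _ n]
    by (cases rule: link_cases) (auto simp: nodes_Gamma card_insert_if)
qed

lemma links_at_node:
  assumes "n > 2" "k \<in> {1..n}"
  shows "{e \<in> links (Gamma_D n). av k \<in> e} = {{av k, bv k}, {av k, cv k}, {av k, bv (nxt n k)}}"
    and "{e \<in> links (Gamma_D n). bv k \<in> e} = {{av k, bv k}, {bv k, cv k}, {av (prv n k), bv k}}"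
    and "{e \<in> links (Gamma_D n). cv k \<in> e} = {{av k, cv k}, {bv k, cv k}, {cv k, dv k}}"
    and "{e \<in> links (Gamma_D n). dv k \<in> e} = {{cv k, dv k}, {dv k, dv (nxt n k)}, {dv (prv n k), dv k}}"
proof -
  have 1: "n \<ge> 1" using assms by simp
  note m = link_mem[OF assms(2)] link_mem(5,6)[OF prv_mem[OF assms(2)], unfolded nxt_prv[OF assms(2)]]
  show "{e \<in> links (Gamma_D n). av k \<in> e} = {{av k, bv k}, {av k, cv k}, {av k, bv (nxt n k)}}"
  proof (intro subset_antisym subsetI)
    fix e assume "e \<in> {e \<in> links (Gamma_D n). av k \<in> e}"
    then have "e \<in> links (Gamma_D n)" and "av k \<in> e" by auto
    from this(1) 1 this(2) show "e \<in> {{av k, bv k}, {av k, cv k}, {av k, bv (nxt n k)}}"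
      using assms(2) by (cases rule: link_cases) auto
  qed (use m in auto)
  show "{e \<in> links (Gamma_D n). bv k \<in> e} = {{av k, bv k}, {bv k, cv k}, {av (prv n k), bv k}}"
  proof (intro subset_antisym subsetI)
    fix e assume "e \<in> {e \<in> links (Gamma_D n). bv k \<in> e}"
    then have "e \<in> links (Gamma_D n)" and "bv k \<in> e" by auto
    from this(1) 1 this(2) show "e \<in> {{av k, bv k}, {bv k, cv k}, {av (prv n k), bv k}}"
      using assms(2) by (cases rule: link_cases) auto
  qed (use m in auto)
  show "{e \<in> links (Gamma_D n). cv k \<in> e} = {{av k, cv k}, {bv k, cv k}, {cv k, dv k}}"
  proof (intro subset_antisym subsetI)
    fix e assume "e \<in> {e \<in> links (Gamma_D n). cv k \<in> e}"
    then have "e \<in> links (Gamma_D n)" and "cv k \<in> e" by auto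
    from this(1) 1 this(2) show "e \<in> {{av k, cv k}, {bv k, cv k}, {cv k, dv k}}"
      using assms(2) by (cases rule: link_cases) auto
  qed (use m in auto)
  show "{e \<in> links (Gamma_D n). dv k \<in> e} = {{cv k, dv k}, {dv k, dv (nxt n k)}, {dv (prv n k), dv k}}"
  proof (intro subset_antisym subsetI)
    fix e assume "e \<in> {e \<in> links (Gamma_D n). dv k \<in> e}"
    then have "e \<in> links (Gamma_D n)" and "dv k \<in> e" by auto
    from this(1) 1 this(2) show "e \<in> {{cv k, dv k}, {dv k, dv (nxt n k)}, {dv (prv n k), dv k}}"
      using assms(2) by (cases rule: link_cases) auto
  qed (use m in auto)
qed

lemma cubic_Gamma:
  assumes "n > 2"
  shows "cubic (Gamma_D n)"
  using assms nxt_neq[of n, symmetric] prv_neq[of n, symmetric] prv_neq_nxt[of n, symmetric]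
  by (auto simp: cubic_def nodes_Gamma links_at_node card_insert_if doubleton_eq_iff)

lemma card_nodes_Gamma: "card (nodes (Gamma_D n)) = 4 * n"
  unfolding nodes_Gamma
  by (subst card_Un_disjoint; (auto simp: card_image inj_on_def)?)+

section \<open>Three-connectivity\<close>

text \<open>Instead of constructing paths one may show that a node set with no edge leaving it contains all
  nodes as soon as it contains one. Along an edge between surviving nodes this is an equivalence of two
  memberships, so that reasoning in a fixed finite piece of the graph becomes propositional.\<close>

lemma graph_connectedI:
  assumes "\<And>U u v. \<lbrakk>\<And>e x y. \<lbrakk>e \<in> links G; ends G e = {x, y}; x \<in> U\<rbrakk> \<Longrightarrow> y \<in> U;
      u \<in> nodes G; v \<in> nodes G; u \<in> U\<rbrakk> \<Longrightarrow> v \<in> U"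
  shows "graph_connected G"
  unfolding graph_connected_def
proof (intro ballI)
  fix u v assume uv: "u \<in> nodes G" "v \<in> nodes G"
  define r where "r = {(x, y). \<exists>e \<in> links G. ends G e = {x, y}}"
  have "y \<in> r\<^sup>* `` {u}" if "e \<in> links G" "ends G e = {x, y}" "x \<in> r\<^sup>* `` {u}" for e x y
    using that by (auto simp: r_def intro: rtrancl_into_rtrancl)
  from assms[of "r\<^sup>* `` {u}", OF this] uv show "(u, v) \<in> r\<^sup>*" by auto
qed

definition column :: "nat \<Rightarrow> gamma_node set" where
  "column k = {av k, bv k, cv k, dv k}"

text \<open>Two neighbouring columns \<open>a, b, c, d\<close> and \<open>a', b', c', d'\<close> induce a 2-connected graph: it contains the
  cycle \<open>a b' c' d' d c\<close>, the node \<open>b\<close> is joined to both \<open>a\<close> and \<open>c\<close>, and \<open>a'\<close> is joined to both \<open>b'\<close>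
  and \<open>c'\<close>. Hence the loss of a single node (those in \<open>S\<close> are lost) does not disconnect it.\<close>

lemma two_columns_connected:
  assumes k: "k \<in> {1..n}" and n: "n > 1"
    and live: "\<And>x y. \<lbrakk>{x, y} \<in> links (Gamma_D n); x \<notin> S; y \<notin> S\<rbrakk> \<Longrightarrow> x \<in> U \<longleftrightarrow> y \<in> U"
    and one: "\<And>x y. \<lbrakk>x \<in> S; y \<in> S; x \<in> column k \<union> column (nxt n k); y \<in> column k \<union> column (nxt n k)\<rbrakk> \<Longrightarrow> x = y"
    and xy: "x \<in> column k \<union> column (nxt n k) - S" "y \<in> column k \<union> column (nxt n k) - S"
  shows "x \<in> U \<longleftrightarrow> y \<in> U"
proof -
  have neq: "k \<noteq> nxt n k" using nxt_neq[OF n k] by simp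
  define A B C D A' B' C' D' where names: "A = av k" "B = bv k" "C = cv k" "D = dv k"
    "A' = av (nxt n k)" "B' = bv (nxt n k)" "C' = cv (nxt n k)" "D' = dv (nxt n k)"
  have cols: "column k \<union> column (nxt n k) = {A, B, C, D, A', B', C', D'}"
    by (auto simp: column_def names)
  have dist: "distinct [A, B, C, D, A', B', C', D']" using neq by (simp add: names)
  note l = link_mem(1-4)[OF k, folded names] link_mem(1-4)[OF nxt_mem[OF k], folded names]
    link_mem(5,6)[OF k, folded names]
  have L: "x \<in> S \<or> y \<in> S \<or> (x \<in> U) = (y \<in> U)" if "{x, y} \<in> links (Gamma_D n)" for x y
    using live that by blast
  note L = l[THEN L]
  have only: "y \<in> S \<longleftrightarrow> x = y" if "x \<in> S" "x \<in> {A, B, C, D, A', B', C', D'}"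
    "y \<in> {A, B, C, D, A', B', C', D'}" for x y
    using one that unfolding cols by blast
  have O1: "A \<in> S \<Longrightarrow> \<not> (B \<in> S \<or> C \<in> S \<or> D \<in> S \<or> A' \<in> S \<or> B' \<in> S \<or> C' \<in> S \<or> D' \<in> S)"
    using dist by (simp add: only[of "A"])
  have O2: "B \<in> S \<Longrightarrow> \<not> (C \<in> S \<or> D \<in> S \<or> A' \<in> S \<or> B' \<in> S \<or> C' \<in> S \<or> D' \<in> S)"
    using dist by (simp add: only[of "B"])
  have O3: "C \<in> S \<Longrightarrow> \<not> (D \<in> S \<or> A' \<in> S \<or> B' \<in> S \<or> C' \<in> S \<or> D' \<in> S)"
    using dist by (simp add: only[of "C"])
  have O4: "D \<in> S \<Longrightarrow> \<not> (A' \<in> S \<or> B' \<in> S \<or> C' \<in> S \<or> D' \<in> S)"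
    using dist by (simp add: only[of "D"])
  have O5: "A' \<in> S \<Longrightarrow> \<not> (B' \<in> S \<or> C' \<in> S \<or> D' \<in> S)"
    using dist by (simp add: only[of "A'"])
  have O6: "B' \<in> S \<Longrightarrow> \<not> (C' \<in> S \<or> D' \<in> S)"
    using dist by (simp add: only[of "B'"])
  have O7: "C' \<in> S \<Longrightarrow> \<not> (D' \<in> S)"
    using dist by (simp add: only[of "C'"])
  have "((A \<in> S \<or> A \<in> U) \<and> (B \<in> S \<or> B \<in> U) \<and> (C \<in> S \<or> C \<in> U) \<and> (D \<in> S \<or> D \<in> U) \<and>
      (A' \<in> S \<or> A' \<in> U) \<and> (B' \<in> S \<or> B' \<in> U) \<and> (C' \<in> S \<or> C' \<in> U) \<and> (D' \<in> S \<or> D' \<in> U)) \<or>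
    ((A \<in> S \<or> A \<notin> U) \<and> (B \<in> S \<or> B \<notin> U) \<and> (C \<in> S \<or> C \<notin> U) \<and> (D \<in> S \<or> D \<notin> U) \<and>
      (A' \<in> S \<or> A' \<notin> U) \<and> (B' \<in> S \<or> B' \<notin> U) \<and> (C' \<in> S \<or> C' \<notin> U) \<and> (D' \<in> S \<or> D' \<notin> U))"
    using L O1 O2 O3 O4 O5 O6 O7 by satx
  then have "(\<forall>x \<in> {A, B, C, D, A', B', C', D'}. x \<notin> S \<longrightarrow> x \<in> U) \<or>
      (\<forall>x \<in> {A, B, C, D, A', B', C', D'}. x \<notin> S \<longrightarrow> x \<notin> U)"
    by blast
  then show ?thesis using xy unfolding cols by blast
qed

lemma disjoint_from_small_set:
  assumes "finite S" "card S < 3" "P \<inter> Q = {}" "P \<inter> R = {}" "Q \<inter> R = {}"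
  obtains "S \<inter> P = {}" | "S \<inter> Q = {}" | "S \<inter> R = {}"
proof (rule ccontr)
  assume "\<not> thesis"
  then have "S \<inter> P \<noteq> {}" "S \<inter> Q \<noteq> {}" "S \<inter> R \<noteq> {}" using that by auto
  then obtain x y z where xyz: "x \<in> S \<inter> P" "y \<in> S \<inter> Q" "z \<in> S \<inter> R" by blast
  then have "card {x, y, z} = 3" using assms(3-5) by (auto simp: card_insert_if)
  moreover have "card {x, y, z} \<le> card S" using xyz assms(1) by (intro card_mono) auto
  ultimately show False using assms(2) by simp
qed

text \<open>Let \<open>S\<close> be the set of at most two deleted nodes, and let \<open>j\<close> be a column that meets \<open>S\<close> (any column if
  \<open>S\<close> is empty). Outside column \<open>j\<close> at most one node is deleted, so every pair of neighbouring columns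
  different from \<open>j\<close> stays connected, and walking around the ring from \<open>j + 1\<close> to \<open>j - 1\<close> connects all these
  columns. Finally each node of column \<open>j\<close> has three paths to other columns that are disjoint except
  for that node, and \<open>S\<close> cannot block all three.\<close>

lemma k_connected_Gamma:
  assumes n: "n > 2"
  shows "k_connected 3 (Gamma_D n)"
  unfolding k_connected_def
proof (intro conjI allI impI)
  show "3 < card (nodes (Gamma_D n))" using n by (simp add: card_nodes_Gamma)
next
  fix S assume S: "S \<subseteq> nodes (Gamma_D n)" and "finite S \<and> card S < 3"
  then have fin: "finite S" and small: "card S < 3" by auto
  show "graph_connected (delete_nodes (Gamma_D n) S)"
  proof (rule graph_connectedI)
    fix U u v
    assume U: "\<And>e x y. \<lbrakk>e \<in> links (delete_nodes (Gamma_D n) S);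
        ends (delete_nodes (Gamma_D n) S) e = {x, y}; x \<in> U\<rbrakk> \<Longrightarrow> y \<in> U"
      and uv: "u \<in> nodes (delete_nodes (Gamma_D n) S)" "v \<in> nodes (delete_nodes (Gamma_D n) S)"
      and u: "u \<in> U"
    have live: "x \<in> U \<longleftrightarrow> y \<in> U" if "{x, y} \<in> links (Gamma_D n)" "x \<notin> S" "y \<notin> S" for x y
      using U[of "{x, y}" x y] U[of "{x, y}" y x] that by (auto simp: delete_nodes_def insert_commute)
    \<comment> \<open>A column that meets \<open>S\<close> contains one of its at most two nodes.\<close>
    obtain j where j: "j \<in> {1..n}" and one: "\<And>x y. \<lbrakk>x \<in> S - column j; y \<in> S - column j\<rbrakk> \<Longrightarrow> x = y"
    proof (cases "S = {}")
      case True
      show thesis by (rule that[of 1]) (use True n in auto)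
    next
      case False
      then obtain x where x: "x \<in> S" by blast
      then have "x \<in> nodes (Gamma_D n)" using S by blast
      then obtain j where "j \<in> {1..n}" "x \<in> column j" unfolding nodes_Gamma column_def by auto
      with x have j: "j \<in> {1..n}" "S \<inter> column j \<noteq> {}" by auto
      then have "card (S - column j) < card S"
        using fin by (intro psubset_card_mono) auto
      then have "card (S - column j) \<le> Suc 0" using small by simp
      then show thesis using that[OF j(1)] fin by (metis card_le_Suc0_iff_eq finite_Diff)
    qed
    have disj: "column i \<inter> column j = {}" if "i \<noteq> j" for i
      using that by (auto simp: column_def)
    have pair: "x \<in> U \<longleftrightarrow> y \<in> U"
      if "i \<in> {1..n}" "i \<noteq> j" "nxt n i \<noteq> j" "x \<in> column i \<union> column (nxt n i) - S"
        "y \<in> column i \<union> column (nxt n i) - S" for i x y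
    proof (rule two_columns_connected[of i n S U])
      show "x = y" if "x \<in> S" "y \<in> S" "x \<in> column i \<union> column (nxt n i)"
        "y \<in> column i \<union> column (nxt n i)" for x y
        using that one disj \<open>i \<noteq> j\<close> \<open>nxt n i \<noteq> j\<close> by blast
    qed (use that live n in auto)
    have survivor: "\<exists>x. x \<in> column i - S" if "i \<noteq> j" for i
    proof (rule ccontr)
      assume "\<not> (\<exists>x. x \<in> column i - S)"
      then have "av i \<in> S - column j" "bv i \<in> S - column j" using disj[OF that] by (auto simp: column_def)
      then show False using one by blast
    qed
    have next_j: "nxt n j \<noteq> j" "nxt n (nxt n j) \<noteq> j" "nxt n j \<in> {1..n}" "prv n j \<noteq> j" "prv n j \<in> {1..n}"
      using nxt_neq[of n j] nxt_nxt_neq[of n j] prv_neq[of n j] prv_mem[OF j] nxt_mem[OF j] n j by auto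
    \<comment> \<open>A reference node: it will turn out that all surviving nodes agree with it on membership in \<open>U\<close>.\<close>
    obtain x0 where x0: "x0 \<in> column (nxt n j) - S" using survivor next_j by blast
    have other: "\<forall>x \<in> column i - S. x \<in> U \<longleftrightarrow> x0 \<in> U" if "i \<in> {1..n}" "i \<noteq> j" for i

    proof (rule cycle_walk_induct[OF j _ _ that])
      show "\<forall>x \<in> column (nxt n j) - S. x \<in> U \<longleftrightarrow> x0 \<in> U"
        using pair[of "nxt n j"] next_j x0 by blast
    next
      fix i assume i: "i \<in> {1..n}" "i \<noteq> j" "nxt n i \<noteq> j" "\<forall>x \<in> column i - S. x \<in> U \<longleftrightarrow> x0 \<in> U"
      obtain y where y: "y \<in> column i - S" using survivor i by blast
      show "\<forall>x \<in> column (nxt n i) - S. x \<in> U \<longleftrightarrow> x0 \<in> U"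
        using pair[OF i(1-3), of _ y] y i(4) by blast
    qed
    have reach: "av (prv n j) \<notin> S \<Longrightarrow> av (prv n j) \<in> U \<longleftrightarrow> x0 \<in> U" "dv (prv n j) \<notin> S \<Longrightarrow> dv (prv n j) \<in> U \<longleftrightarrow> x0 \<in> U"
        "bv (nxt n j) \<notin> S \<Longrightarrow> bv (nxt n j) \<in> U \<longleftrightarrow> x0 \<in> U" "dv (nxt n j) \<notin> S \<Longrightarrow> dv (nxt n j) \<in> U \<longleftrightarrow> x0 \<in> U"
      using other[of "nxt n j"] other[of "prv n j"] next_j by (auto simp: column_def)
    note l = link_mem[OF j, THEN live] link_mem[OF prv_mem[OF j], THEN live, simplified nxt_prv[OF j]]
    have last: "x \<in> U \<longleftrightarrow> x0 \<in> U" if "x \<in> column j" "x \<notin> S" for x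
    proof -
      consider "x = av j" | "x = bv j" | "x = cv j" | "x = dv j" using \<open>x \<in> column j\<close> by (auto simp: column_def)
      then show ?thesis
      proof cases
        case 1
        show ?thesis
          by (rule disjoint_from_small_set[OF fin small,
                of "{bv (nxt n j)}" "{bv j, av (prv n j)}" "{cv j, dv j, dv (nxt n j)}"])
            (use 1 next_j l reach \<open>x \<notin> S\<close> in auto)
      next
        case 2
        show ?thesis
          by (rule disjoint_from_small_set[OF fin small,
                of "{av (prv n j)}" "{av j, bv (nxt n j)}" "{cv j, dv j, dv (nxt n j)}"])
            (use 2 next_j l reach \<open>x \<notin> S\<close> in auto)
      next
        case 3
        show ?thesis
          by (rule disjoint_from_small_set[OF fin small,
                of "{av j, bv (nxt n j)}" "{bv j, av (prv n j)}" "{dv j, dv (nxt n j)}"])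
            (use 3 next_j l reach \<open>x \<notin> S\<close> in auto)
      next
        case 4
        show ?thesis
          by (rule disjoint_from_small_set[OF fin small,
                of "{dv (nxt n j)}" "{dv (prv n j)}" "{cv j, av j, bv (nxt n j)}"])
            (use 4 next_j l reach \<open>x \<notin> S\<close> prv_neq_nxt[OF n j] in auto)
      qed
    qed
    have all: "x \<in> U \<longleftrightarrow> x0 \<in> U" if "x \<in> nodes (delete_nodes (Gamma_D n) S)" for x
    proof -
      have "x \<notin> S" "\<exists>i \<in> {1..n}. x \<in> column i"
        using that unfolding delete_nodes_def nodes_Gamma column_def by auto
      then show ?thesis using other last by blast
    qed
    show "v \<in> U" using all uv u by blast
  qed
qed

section \<open>Planarity\<close>

text \<open>To see that a drawing has no crossings one would have to compare all pairs of edges. A labelling of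
  the points of the plane avoids this: if nodes are labelled by themselves and the interior points of
  each arc by the end nodes of its edge, then interiors of different arcs are disjoint and contain no
  node, because an edge has two end nodes and different edges have different ends.\<close>

lemma planar_by_labelling:
  fixes G :: "('v, 'e, 'z) ugraph_scheme" and p :: "'v \<Rightarrow> complex" and label :: "complex \<Rightarrow> 'v set"
  assumes G: "graph G" "inj_on (ends G) (links G)"
    and nodes: "\<And>v. v \<in> nodes G \<Longrightarrow> label (p v) = {v}"
    and arcs: "\<And>e. e \<in> links G \<Longrightarrow> \<exists>g. arc g \<and> {pathstart g, pathfinish g} = p ` ends G e \<and>
       (\<forall>t \<in> {0<..<1}. label (g t) = ends G e)"
  shows "planar G"
proof -
  obtain \<gamma> where \<gamma>: "arc (\<gamma> e)" "{pathstart (\<gamma> e), pathfinish (\<gamma> e)} = p ` ends G e"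
    "\<forall>t \<in> {0<..<1}. label (\<gamma> e t) = ends G e" if "e \<in> links G" for e
    using arcs by metis
  have inj: "inj_on p (nodes G)"
    using nodes by (metis inj_onI singleton_inject)
  have ends: "ends G e \<subseteq> nodes G" "card (ends G e) = 2" if "e \<in> links G" for e
    using G that by (auto simp: graph_def)
  have image: "path_image (\<gamma> e) = p ` ends G e \<union> \<gamma> e ` {0<..<1}" if "e \<in> links G" for e
  proof -
    have "{0..1} = {0, 1} \<union> {0<..<1::real}" by auto
    then show ?thesis
      using \<gamma>(2)[OF that] by (auto simp: path_image_def pathstart_def pathfinish_def)
  qed
  have at_end: "z \<in> p ` ends G e" if "e \<in> links G" "z \<in> path_image (\<gamma> e)" "label z \<noteq> ends G e" for e z
    using that image \<gamma>(3) by auto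
  have not_single: "ends G e \<noteq> {v}" if "e \<in> links G" for e v
    using ends(2)[OF that] by auto
  show ?thesis
    unfolding planar_def
  proof (intro exI[of _ p] exI[of _ \<gamma>] conjI ballI impI)
    fix e assume e: "e \<in> links G"
    show "path_image (\<gamma> e) \<inter> p ` nodes G = p ` ends G e"
    proof
      show "path_image (\<gamma> e) \<inter> p ` nodes G \<subseteq> p ` ends G e"
        using at_end[OF e] not_single[OF e] nodes by fastforce
      show "p ` ends G e \<subseteq> path_image (\<gamma> e) \<inter> p ` nodes G"
        using image[OF e] ends[OF e] by blast
    qed
  next
    fix e f assume ef: "e \<in> links G" "f \<in> links G" "e \<noteq> f"
    have "z \<in> p ` (ends G e \<inter> ends G f)" if z: "z \<in> path_image (\<gamma> e)" "z \<in> path_image (\<gamma> f)" for z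
    proof -
      have "ends G e \<noteq> ends G f" using G(2) ef by (auto dest: inj_onD)
      moreover have "label z \<noteq> ends G e" if "z \<in> p ` ends G f"
        using that nodes ends[OF ef(2)] not_single[OF ef(1)] by fastforce
      moreover have "label z \<noteq> ends G f" if "z \<in> p ` ends G e"
        using that nodes ends[OF ef(1)] not_single[OF ef(2)] by fastforce
      ultimately have "z \<in> p ` ends G e" "z \<in> p ` ends G f"
        using at_end ef z by metis+
      then show ?thesis
        using inj ends[OF ef(1)] ends[OF ef(2)] by (auto simp: inj_on_image_Int)
    qed
    then show "path_image (\<gamma> e) \<inter> path_image (\<gamma> f) = p ` (ends G e \<inter> ends G f)"
      using image ef by blast
  qed (use \<gamma> inj in auto)
qed

text \<open>The segment from \<open>z\<close> to \<open>w\<close>, bent upwards by a parabola of height \<open>c / 4\<close>.\<close>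

definition bent_path :: "complex \<Rightarrow> complex \<Rightarrow> real \<Rightarrow> real \<Rightarrow> complex" where
  "bent_path z w c t = linepath z w t + \<i> * complex_of_real (c * (t * (1 - t)))"

lemma arc_bent_path:
  assumes "z \<noteq> w" "c = 0 \<or> Re z \<noteq> Re w"
  shows "arc (bent_path z w c)"
proof (cases "c = 0")
  case True
  then have "bent_path z w c = linepath z w" by (auto simp: bent_path_def)
  then show ?thesis using assms(1) by (simp add: arc_linepath)
next
  case False
  then have neq: "Re z \<noteq> Re w" using assms by auto
  have "inj_on (bent_path z w c) {0..1}"
  proof (rule inj_onI)
    fix s t assume "bent_path z w c s = bent_path z w c t"
    then have "Re (linepath z w s) = Re (linepath z w t)"
      by (metis Re_i_times Im_complex_of_real add.right_neutral bent_path_def minus_zero plus_complex.sel(1))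
    then have "s * (Re w - Re z) = t * (Re w - Re z)"
      by (simp add: linepath_def algebra_simps)
    then show "s = t" using neq by simp
  qed
  moreover have "path (bent_path z w c)"
    unfolding path_def bent_path_def linepath_def by (intro continuous_intros)
  ultimately show ?thesis by (simp add: arc_def)
qed

lemma bent_path_ends: "pathstart (bent_path z w c) = z" "pathfinish (bent_path z w c) = w"
  by (simp_all add: pathstart_def pathfinish_def bent_path_def linepath_def)

lemma bent_path_coordinates:
  "Re (bent_path z w c t) = Re z + t * (Re w - Re z)"
  "Im (bent_path z w c t) = Im z + t * (Im w - Im z) + c * (t * (1 - t))"
  by (simp_all add: bent_path_def linepath_def algebra_simps)

text \<open>Column \<open>i\<close> is drawn in the part \<open>i \<le> x < i + 1\<close> of the strip \<open>0 \<le> y \<le> 2\<close>. All edges are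
  segments, except for \<open>{a\<^sub>n, b\<^sub>1}\<close> and \<open>{d\<^sub>1, d\<^sub>n}\<close>, which are parabolas above and below the strip.\<close>

fun position :: "gamma_node \<Rightarrow> complex" where
  "position (av i) = Complex (i + 1/2) 2"
| "position (bv i) = Complex i 2"
| "position (cv i) = Complex (i + 1/4) 1"
| "position (dv i) = Complex (i + 1/4) 0"

text \<open>Which node or edge of the drawing passes through \<open>z\<close>, decided by the height of \<open>z\<close> and then by its
  column. On the bottom line the column is shifted by \<open>1/4\<close>, since an edge there leads from
  \<open>d\<^sub>j\<close> at \<open>j + 1/4\<close> to \<open>d\<^sub>j\<^sub>+\<^sub>1\<close>. Points off the drawing receive arbitrary labels.\<close>

definition strip_label :: "nat \<Rightarrow> complex \<Rightarrow> gamma_node set" where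
  "strip_label n z =
     (let x = Re z; y = Im z; i = nat \<lfloor>x\<rfloor>; j = nat \<lfloor>x - 1/4\<rfloor> in
      if y < 0 then {dv n, dv 1}
      else if y = 0 then (if x = j + 1/4 then {dv j} else {dv j, dv (j + 1)})
      else if y < 1 then {cv i, dv i}
      else if y = 1 then {cv i}
      else if y < 2 then (if x < i + 1/4 then {bv i, cv i} else {av i, cv i})
      else if y = 2 then (if x = i then {bv i} else if x < i + 1/2 then {av i, bv i}
        else if x = i + 1/2 then {av i} else {av i, bv (i + 1)})
      else {av n, bv 1})"

lemma nat_floor_eq: "real i \<le> x \<Longrightarrow> x < real i + 1 \<Longrightarrow> nat \<lfloor>x\<rfloor> = i"
  by linarith

lemma strip_label_position: "strip_label n (position v) = {v}"
proof -
  have "nat \<lfloor>real i + 1/2\<rfloor> = i" "nat \<lfloor>real i + 1/4\<rfloor> = i" for i by (rule nat_floor_eq; simp)+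
  then show ?thesis by (cases v) (simp_all add: strip_label_def Let_def)
qed

lemma planar_Gamma:
  assumes n: "n > 2"
  shows "planar (Gamma_D n)"
proof (rule planar_by_labelling[where label = "strip_label n" and p = position])
  show "graph (Gamma_D n)" using n by (intro graph_Gamma) simp
  show "inj_on (ends (Gamma_D n)) (links (Gamma_D n))" by (auto simp: inj_on_def)
  show "strip_label n (position v) = {v}" for v by (rule strip_label_position)
next
  fix e assume e: "e \<in> links (Gamma_D n)"
  have fl: "nat \<lfloor>x\<rfloor> = i" if "real i \<le> x" "x < real i + 1" for x i using that by (rule nat_floor_eq)
  have one: "1 \<le> n" using n by simp
  have "\<exists>u v c. e = {u, v} \<and> position u \<noteq> position v \<and> (c = 0 \<or> Re (position u) \<noteq> Re (position v)) \<and>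
     (\<forall>t \<in> {0<..<1}. strip_label n (bent_path (position u) (position v) c t) = e)"
    using e one
  proof (cases rule: link_cases)
    case (ab k)
    show ?thesis
    proof (rule exI[of _ "bv k"], rule exI[of _ "av k"], rule exI[of _ 0], intro conjI ballI)
      fix t :: real assume t: "t \<in> {0<..<1}"
      then have "nat \<lfloor>real k + t * (1/2)\<rfloor> = k" by (intro fl) auto
      then show "strip_label n (bent_path (position (bv k)) (position (av k)) 0 t) = e"
        using t ab by (auto simp: strip_label_def Let_def bent_path_coordinates)
    qed (use ab in auto)
  next
    case (ac k)
    show ?thesis
    proof (rule exI[of _ "cv k"], rule exI[of _ "av k"], rule exI[of _ 0], intro conjI ballI)
      fix t :: real assume t: "t \<in> {0<..<1}"
      then have "nat \<lfloor>real k + 1/4 + t * (1/4)\<rfloor> = k" by (intro fl) auto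
      then show "strip_label n (bent_path (position (cv k)) (position (av k)) 0 t) = e"
        using t ac by (auto simp: strip_label_def Let_def bent_path_coordinates)
    qed (use ac in auto)
  next
    case (bc k)
    show ?thesis
    proof (rule exI[of _ "cv k"], rule exI[of _ "bv k"], rule exI[of _ 0], intro conjI ballI)
      fix t :: real assume t: "t \<in> {0<..<1}"
      then have "nat \<lfloor>real k + 1/4 - t * (1/4)\<rfloor> = k" by (intro fl) auto
      then show "strip_label n (bent_path (position (cv k)) (position (bv k)) 0 t) = e"
        using t bc by (auto simp: strip_label_def Let_def bent_path_coordinates)
    qed (use bc in auto)
  next
    case (cd k)
    show ?thesis
    proof (rule exI[of _ "dv k"], rule exI[of _ "cv k"], rule exI[of _ 0], intro conjI ballI)
      fix t :: real assume t: "t \<in> {0<..<1}"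
      have "nat \<lfloor>real k + 1/4\<rfloor> = k" by (intro fl) auto
      then show "strip_label n (bent_path (position (dv k)) (position (cv k)) 0 t) = e"
        using t cd by (auto simp: strip_label_def Let_def bent_path_coordinates)
    qed (use cd in auto)
  next
    case (a_next k)
    show ?thesis
    proof (cases "k = n")
      case True
      show ?thesis
      proof (rule exI[of _ "av n"], rule exI[of _ "bv 1"], rule exI[of _ 1], intro conjI ballI)
        fix t :: real assume t: "t \<in> {0<..<1}"
        then have "0 < t * (1 - t)" by simp
        then have "2 < Im (bent_path (position (av n)) (position (bv 1)) 1 t)" by (simp add: bent_path_coordinates del: mult_less_0_iff zero_less_mult_iff)
        then show "strip_label n (bent_path (position (av n)) (position (bv 1)) 1 t) = e"
          using a_next True by (simp add: strip_label_def Let_def nxt_def)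
      qed (use a_next True n in \<open>auto simp: nxt_def\<close>)
    next
      case False
      show ?thesis
      proof (rule exI[of _ "av k"], rule exI[of _ "bv (k + 1)"], rule exI[of _ 0], intro conjI ballI)
        fix t :: real assume t: "t \<in> {0<..<1}"
        then have "nat \<lfloor>real k + 1/2 + t * (1/2)\<rfloor> = k" by (intro fl) auto
        then show "strip_label n (bent_path (position (av k)) (position (bv (k + 1))) 0 t) = e"
          using t a_next False by (auto simp: strip_label_def Let_def bent_path_coordinates nxt_def)
      qed (use a_next False in \<open>auto simp: nxt_def\<close>)
    qed
  next
    case (d_next k)
    show ?thesis
    proof (cases "k = n")
      case True
      show ?thesis
      proof (rule exI[of _ "dv n"], rule exI[of _ "dv 1"], rule exI[of _ "-1"], intro conjI ballI)
        fix t :: real assume t: "t \<in> {0<..<1}"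
        then have "0 < t * (1 - t)" by simp
        then have "Im (bent_path (position (dv n)) (position (dv 1)) (-1) t) < 0" by (simp add: bent_path_coordinates del: mult_less_0_iff zero_less_mult_iff)
        then show "strip_label n (bent_path (position (dv n)) (position (dv 1)) (-1) t) = e"
          using d_next True by (simp add: strip_label_def Let_def nxt_def)
      qed (use d_next True n in \<open>auto simp: nxt_def\<close>)
    next
      case False
      show ?thesis
      proof (rule exI[of _ "dv k"], rule exI[of _ "dv (k + 1)"], rule exI[of _ 0], intro conjI ballI)
        fix t :: real assume t: "t \<in> {0<..<1}"
        then have "nat \<lfloor>real k + t\<rfloor> = k" by (intro fl) auto
        then show "strip_label n (bent_path (position (dv k)) (position (dv (k + 1))) 0 t) = e"
          using t d_next False by (auto simp: strip_label_def Let_def bent_path_coordinates nxt_def)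
      qed (use d_next False in \<open>auto simp: nxt_def\<close>)
    qed
  qed
  then obtain u v c where uv: "e = {u, v}" "position u \<noteq> position v" "c = 0 \<or> Re (position u) \<noteq> Re (position v)"
    "\<forall>t \<in> {0<..<1}. strip_label n (bent_path (position u) (position v) c t) = e" by blast
  then show "\<exists>g. arc g \<and> {pathstart g, pathfinish g} = position ` ends (Gamma_D n) e \<and>
       (\<forall>t \<in> {0<..<1}. strip_label n (g t) = ends (Gamma_D n) e)"
    by (intro exI[of _ "bent_path (position u) (position v) c"]) (simp add: arc_bent_path bent_path_ends)
qed

section \<open>Surfaces from sets of triangles\<close>

text \<open>The simplices are the vertex sets of the vertices, edges and faces: the non-empty subsets of triangles.\<close>

definition simplices :: "'v set set \<Rightarrow> 'v set set" where
  "simplices T = {s. s \<noteq> {} \<and> (\<exists>t \<in> T. s \<subseteq> t)}"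

text \<open>A set of triangles determines a surface whose incidence is strict inclusion of simplices. Since a
  surface has all its elements in one type, such as the natural numbers, the elements are not the simplices
  themselves but their codes under a function that is injective on simplices.\<close>

definition coded_surface :: "('v set \<Rightarrow> 'a) \<Rightarrow> 'v set set \<Rightarrow> 'a surface" where
  "coded_surface code T =
     \<lparr>vertices = code ` {s \<in> simplices T. card s = 1}, edges = code ` {s \<in> simplices T. card s = 2},
      faces = code ` T,
      incident = (\<lambda>x y. \<exists>s \<in> simplices T. \<exists>t \<in> simplices T. x = code s \<and> y = code t \<and> s \<subset> t)\<rparr>"

definition induced :: "('v set \<Rightarrow> 'a) \<Rightarrow> 'v set set \<Rightarrow> ('v \<Rightarrow> 'v) \<Rightarrow> 'a \<Rightarrow> 'a" where
  "induced code T g =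
     restrict (\<lambda>x. code (g ` inv_into (simplices T) code x)) (code ` simplices T)"

text \<open>The boundary of a face consists of all elements incident to it. A bijection that preserves incidence
  in both directions therefore respects boundaries automatically.\<close>

lemma carrier_Aut:
  assumes "simplicial_surface X"
  shows "carrier (Aut X) = {\<pi> \<in> Bij (elements X).
    \<forall>A \<in> elements X. \<forall>B \<in> elements X. A \<triangleleft>\<^bsub>X\<^esub> B \<longleftrightarrow> \<pi> A \<triangleleft>\<^bsub>X\<^esub> \<pi> B}"
proof -
  interpret simplicial_surface X by fact
  have bd: "boundary X F = {A \<in> elements X. A \<triangleleft>\<^bsub>X\<^esub> F}" for F
    using incident_in disjoint by (fastforce simp: boundary_def elements_def)
  have hom: "\<pi> \<in> surface_hom X X"
    if bij: "bij_betw \<pi> (elements X) (elements X)"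
      and inc: "\<forall>A \<in> elements X. \<forall>B \<in> elements X. A \<triangleleft>\<^bsub>X\<^esub> B \<longleftrightarrow> \<pi> A \<triangleleft>\<^bsub>X\<^esub> \<pi> B" for \<pi>
  proof -
    have "bij_betw \<pi> (boundary X F) (boundary X (\<pi> F))" if "F \<in> faces X" for F
    proof -
      have F: "F \<in> elements X" using that by (simp add: elements_def)
      have "\<pi> ` boundary X F = boundary X (\<pi> F)"
      proof (intro subset_antisym subsetI)
        fix B assume "B \<in> boundary X (\<pi> F)"
        then have B: "B \<in> \<pi> ` elements X" "B \<triangleleft>\<^bsub>X\<^esub> \<pi> F"
          unfolding bd using bij_betw_imp_surj_on[OF bij] by auto
        then show "B \<in> \<pi> ` boundary X F" unfolding bd using inc F by blast
      next
        fix B assume "B \<in> \<pi> ` boundary X F"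
        then show "B \<in> boundary X (\<pi> F)"
          using inc F bij_betw_apply[OF bij] by (auto simp: bd)
      qed
      moreover have "boundary X F \<subseteq> elements X" by (auto simp: bd)
      ultimately show ?thesis by (intro bij_betw_subset[OF bij])
    qed
    moreover have "\<pi> \<in> elements X \<rightarrow> elements X" using bij by (auto simp: bij_betw_def)
    moreover have "boundary X F \<subseteq> elements X" for F by (auto simp: bd)
    ultimately show ?thesis using inc unfolding surface_hom_def by blast
  qed
  show ?thesis
  proof (intro subset_antisym subsetI)
    fix \<pi> assume "\<pi> \<in> carrier (Aut X)"
    then have \<pi>: "\<pi> \<in> Bij (elements X)" "\<pi> \<in> surface_hom X X" "inv_into (elements X) \<pi> \<in> surface_hom X X"
      by (auto simp: Aut_def)
    then have bij: "bij_betw \<pi> (elements X) (elements X)" by (simp add: Bij_def)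
    have "A \<triangleleft>\<^bsub>X\<^esub> B \<longleftrightarrow> \<pi> A \<triangleleft>\<^bsub>X\<^esub> \<pi> B" if "A \<in> elements X" "B \<in> elements X" for A B
    proof
      assume "A \<triangleleft>\<^bsub>X\<^esub> B"
      then show "\<pi> A \<triangleleft>\<^bsub>X\<^esub> \<pi> B" using \<pi>(2) that by (auto simp: surface_hom_def)
    next
      assume "\<pi> A \<triangleleft>\<^bsub>X\<^esub> \<pi> B"
      then have "inv_into (elements X) \<pi> (\<pi> A) \<triangleleft>\<^bsub>X\<^esub> inv_into (elements X) \<pi> (\<pi> B)"
        using \<pi>(3) that bij by (simp add: surface_hom_def bij_betw_apply)
      then show "A \<triangleleft>\<^bsub>X\<^esub> B"
        using that bij by (simp add: bij_betw_inv_into_left)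
    qed
    then show "\<pi> \<in> {\<pi> \<in> Bij (elements X).
        \<forall>A \<in> elements X. \<forall>B \<in> elements X. A \<triangleleft>\<^bsub>X\<^esub> B \<longleftrightarrow> \<pi> A \<triangleleft>\<^bsub>X\<^esub> \<pi> B}"
      using \<pi>(1) by blast
  next
    fix \<pi> assume "\<pi> \<in> {\<pi> \<in> Bij (elements X).
        \<forall>A \<in> elements X. \<forall>B \<in> elements X. A \<triangleleft>\<^bsub>X\<^esub> B \<longleftrightarrow> \<pi> A \<triangleleft>\<^bsub>X\<^esub> \<pi> B}"
    then have \<pi>: "\<pi> \<in> Bij (elements X)"
      and inc: "\<forall>A \<in> elements X. \<forall>B \<in> elements X. A \<triangleleft>\<^bsub>X\<^esub> B \<longleftrightarrow> \<pi> A \<triangleleft>\<^bsub>X\<^esub> \<pi> B" by auto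
    have bij: "bij_betw \<pi> (elements X) (elements X)" using \<pi> by (simp add: Bij_def)
    let ?i = "inv_into (elements X) \<pi>"
    have "A \<triangleleft>\<^bsub>X\<^esub> B \<longleftrightarrow> ?i A \<triangleleft>\<^bsub>X\<^esub> ?i B" if "A \<in> elements X" "B \<in> elements X" for A B
      using inc bij_betw_apply[OF bij_betw_inv_into[OF bij]] that bij_betw_inv_into_right[OF bij]
      by metis
    then have "?i \<in> surface_hom X X" using hom bij_betw_inv_into[OF bij] by blast
    then show "\<pi> \<in> carrier (Aut X)"
      using \<pi> hom[OF bij inc] by (simp add: Aut_def)
  qed
qed

text \<open>Any finite set of three-element sets yields edges with two vertices and faces with three edges and three
  vertices. What remains to be required is that an edge lies in two triangles, and that the
  triangles at a vertex form a cycle of length at least 3. In the latter condition it suffices that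
  consecutive triangles share two vertices, because the central vertex is one of them.\<close>

locale triangulation =
  fixes T :: "'v set set" and code :: "'v set \<Rightarrow> 'a"
  assumes finite_T: "finite T" and nonempty_T: "T \<noteq> {}"
    and card_triangle: "t \<in> T \<Longrightarrow> card t = 3"
    and two_triangles: "\<lbrakk>t \<in> T; e \<subseteq> t; card e = 2\<rbrakk> \<Longrightarrow> card {t \<in> T. e \<subseteq> t} = 2"
    and umbrella_T: "v \<in> \<Union>T \<Longrightarrow> \<exists>ts. distinct ts \<and> set ts = {t \<in> T. v \<in> t} \<and> 3 \<le> length ts \<and>
      (\<forall>i < length ts. card (ts ! i \<inter> ts ! (Suc i mod length ts)) = 2)"
    and inj_code: "inj_on code (simplices T)"
begin

abbreviation "X \<equiv> coded_surface code T"

lemma finite_triangle: "t \<in> T \<Longrightarrow> finite t"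
  using card_triangle by (metis card.infinite zero_neq_numeral)

lemma finite_simplex: "s \<in> simplices T \<Longrightarrow> finite s"
  using finite_triangle by (auto simp: simplices_def intro: finite_subset)

lemma finite_simplices: "finite (simplices T)"
proof -
  have "simplices T \<subseteq> (\<Union>t \<in> T. Pow t)" by (auto simp: simplices_def)
  then show ?thesis using finite_T finite_triangle by (auto intro: finite_subset)
qed

lemma triangle_simplex: "t \<in> T \<Longrightarrow> t \<in> simplices T"
  using card_triangle[of t] by (auto simp: simplices_def)

lemma simplex_mono:
  assumes "s \<in> simplices T" "r \<subseteq> s" "r \<noteq> {}"
  shows "r \<in> simplices T"
proof -
  obtain t where "t \<in> T" "s \<subseteq> t" using assms(1) by (auto simp: simplices_def)
  then have "t \<in> T" "r \<subseteq> t" using assms(2) by simp_all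
  then show ?thesis using assms(3) unfolding simplices_def by blast
qed

lemma singleton_simplex: "{v} \<in> simplices T \<longleftrightarrow> v \<in> \<Union>T"
  by (auto simp: simplices_def)

lemma card_simplex: "s \<in> simplices T \<Longrightarrow> card s = 1 \<or> card s = 2 \<or> card s = 3"
proof -
  assume s: "s \<in> simplices T"
  then obtain t where t: "t \<in> T" "s \<subseteq> t" by (auto simp: simplices_def)
  have "card s \<le> 3" using card_mono[OF finite_triangle] t card_triangle by metis
  moreover have "card s \<noteq> 0" using s finite_simplex by (auto simp: simplices_def)
  ultimately show ?thesis by linarith
qed

lemma triangle_iff: "t \<in> T \<longleftrightarrow> t \<in> simplices T \<and> card t = 3"
  using triangle_simplex card_triangle finite_triangle
  by (auto simp: simplices_def) (metis card_subset_eq)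

lemma surface_parts:
  "vertices X = code ` {s \<in> simplices T. card s = 1}"
  "edges X = code ` {s \<in> simplices T. card s = 2}"
  "faces X = code ` T"
  by (simp_all add: coded_surface_def)

lemma elements_X: "elements X = code ` simplices T"
  unfolding elements_def surface_parts triangle_iff[abs_def] using card_simplex triangle_iff by fast

lemma code_eq: "\<lbrakk>s \<in> simplices T; t \<in> simplices T\<rbrakk> \<Longrightarrow> code s = code t \<longleftrightarrow> s = t"
  using inj_code by (auto simp: inj_on_def)

lemma incident_iff:
  assumes "s \<in> simplices T" "t \<in> simplices T"
  shows "code s \<triangleleft>\<^bsub>X\<^esub> code t \<longleftrightarrow> s \<subset> t"
  using assms code_eq by (auto simp: coded_surface_def)

lemma card_code: "A \<subseteq> simplices T \<Longrightarrow> card (code ` A) = card A"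
  by (rule card_image) (rule inj_on_subset[OF inj_code])

lemma below:
  assumes "A \<subseteq> simplices T" "t \<in> simplices T"
  shows "{x \<in> code ` A. x \<triangleleft>\<^bsub>X\<^esub> code t} = code ` {s \<in> A. s \<subset> t}"
  using assms incident_iff by blast

lemma above:
  assumes "A \<subseteq> simplices T" "s \<in> simplices T"
  shows "{x \<in> code ` A. code s \<triangleleft>\<^bsub>X\<^esub> x} = code ` {t \<in> A. s \<subset> t}"
  using assms incident_iff by blast

lemma card_below:
  assumes t: "t \<in> simplices T" and k: "0 < k" "k < card t"
  shows "card {x \<in> code ` {s \<in> simplices T. card s = k}. x \<triangleleft>\<^bsub>X\<^esub> code t} = card t choose k"
proof -
  have "s \<in> simplices T \<and> s \<noteq> t" if "s \<subseteq> t" "card s = k" for s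
    using that k simplex_mono[OF t, of s] by fastforce
  then have "{s \<in> {s \<in> simplices T. card s = k}. s \<subset> t} = {s. s \<subseteq> t \<and> card s = k}"
    by blast
  moreover have "{s \<in> {s \<in> simplices T. card s = k}. s \<subset> t} \<subseteq> simplices T" by blast
  ultimately show ?thesis
    using n_subsets[OF finite_simplex[OF t]] t by (subst below) (simp_all add: card_code)
qed

lemma card_above_edge:
  assumes e: "e \<in> simplices T" "card e = 2"
  shows "{t \<in> T. e \<subset> t} = {t \<in> T. e \<subseteq> t}" "card {t \<in> T. e \<subseteq> t} = 2"
proof -
  show "{t \<in> T. e \<subset> t} = {t \<in> T. e \<subseteq> t}" using e card_triangle by force
  show "card {t \<in> T. e \<subseteq> t} = 2" using e two_triangles by (auto simp: simplices_def)
qed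

lemma above_vertex: "{t \<in> T. {v} \<subset> t} = {t \<in> T. v \<in> t}"
  using card_triangle by force

lemma simplicial_surface_X: "simplicial_surface X"
proof
  have T_sub: "T \<subseteq> simplices T" using triangle_simplex by blast
  show "countable (elements X)" by (simp add: elements_X finite_simplices countable_finite)
  obtain t where t: "t \<in> T" using nonempty_T by blast
  show "faces X \<noteq> {}" using nonempty_T by (simp add: surface_parts)
  obtain x y z where xyz: "t = {x, y, z}" "x \<noteq> y" using card_triangle[OF t] by (metis card_3_iff)
  have "{x} \<in> simplices T" "{x, y} \<in> simplices T"
    using simplex_mono[OF triangle_simplex[OF t]] xyz by auto
  then show "vertices X \<noteq> {}" "edges X \<noteq> {}" using xyz unfolding surface_parts by force+
  have T: "T = {s \<in> simplices T. card s = 3}" using triangle_iff by blast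
  have disj: "code ` {s \<in> simplices T. card s = i} \<inter> code ` {s \<in> simplices T. card s = j} = {}"
    if "i \<noteq> j" for i j
    using that code_eq by auto
  have faces: "faces X = code ` {s \<in> simplices T. card s = 3}"
    unfolding surface_parts(3) by (rule arg_cong[OF T])
  show "vertices X \<inter> edges X = {}" "vertices X \<inter> faces X = {}" "edges X \<inter> faces X = {}"
    unfolding faces surface_parts(1,2) by (rule disj; simp)+
  show "(A, B) \<in> vertices X \<times> edges X \<union> edges X \<times> faces X \<union> vertices X \<times> faces X" if inc: "A \<triangleleft>\<^bsub>X\<^esub> B" for A B
  proof -
    from inc obtain s t where st: "s \<in> simplices T" "t \<in> simplices T" "A = code s" "B = code t" "s \<subset> t"
      by (auto simp: coded_surface_def)
    then have "card s < card t" using finite_simplex by (simp add: psubset_card_mono)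
    then consider "card s = 1" "card t = 2" | "card s = 1" "card t = 3" | "card s = 2" "card t = 3"
      using card_simplex[of s] card_simplex[of t] st by fastforce
    then show ?thesis using st triangle_iff unfolding surface_parts by cases auto
  qed
  show "card {V \<in> vertices X. V \<triangleleft>\<^bsub>X\<^esub> e} = 2" if "e \<in> edges X" for e
    using that card_below[of _ 1] unfolding surface_parts by auto
  show "card {e \<in> edges X. e \<triangleleft>\<^bsub>X\<^esub> F} = 3" if "F \<in> faces X" for F
    using that card_below[of _ 2] T_sub card_triangle unfolding surface_parts by (auto simp: numeral_eq_Suc)
  show "card {V \<in> vertices X. V \<triangleleft>\<^bsub>X\<^esub> F} = 3" if "F \<in> faces X" for F
    using that card_below[of _ 1] T_sub card_triangle unfolding surface_parts by auto
  show "card {e \<in> edges X. e \<triangleleft>\<^bsub>X\<^esub> F \<and> V \<triangleleft>\<^bsub>X\<^esub> e} = 2"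
    if "F \<in> faces X" and V: "V \<in> vertices X" and VF: "V \<triangleleft>\<^bsub>X\<^esub> F" for F V
  proof -
    obtain t where t: "t \<in> T" "F = code t" using \<open>F \<in> faces X\<close> by (auto simp: surface_parts)
    obtain v where v: "{v} \<in> simplices T" "V = code {v}" using V by (auto simp: surface_parts card_1_singleton_iff)
    have "v \<in> t" using VF t v incident_iff triangle_simplex by auto
    then obtain x y where xy: "t = {v, x, y}" "x \<noteq> y" "x \<noteq> v" "y \<noteq> v"
      using card_triangle[OF t(1)] by (auto simp: card_3_iff)
    have e: "{v, x} \<in> simplices T" "{v, y} \<in> simplices T" using simplex_mono[OF triangle_simplex[OF t(1)]] xy by simp_all
    have sub: "e = {v, x} \<or> e = {v, y}" if e: "e \<subset> t" "{v} \<subset> e" "card e = 2" for e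
    proof -
      obtain z where "e = {v, z}" "z \<noteq> v" using e by (auto simp: card_2_iff doubleton_eq_iff)
      then show ?thesis using e xy by auto
    qed
    have "{e \<in> edges X. e \<triangleleft>\<^bsub>X\<^esub> F \<and> V \<triangleleft>\<^bsub>X\<^esub> e} = code ` {e \<in> simplices T. card e = 2 \<and> e \<subset> t \<and> {v} \<subset> e}"
      using incident_iff[OF _ triangle_simplex[OF t(1)]] incident_iff[OF v(1)] by (auto simp: surface_parts t(2) v(2))
    also have "{e \<in> simplices T. card e = 2 \<and> e \<subset> t \<and> {v} \<subset> e} = {{v, x}, {v, y}}"
    proof (intro subset_antisym subsetI)
      fix f assume "f \<in> {{v, x}, {v, y}}"
      moreover have "{v, x} \<subset> t" "{v, y} \<subset> t" "{v} \<subset> {v, x}" "{v} \<subset> {v, y}" "card {v, x} = 2" "card {v, y} = 2"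
        using xy by auto
      ultimately show "f \<in> {e \<in> simplices T. card e = 2 \<and> e \<subset> t \<and> {v} \<subset> e}"
        using e by (elim insertE emptyE) simp_all
    qed (use sub in blast)
    finally show ?thesis using xy e code_eq by (auto simp: doubleton_eq_iff card_insert_if)
  qed
  show "card {F \<in> faces X. e \<triangleleft>\<^bsub>X\<^esub> F} = 2" if e: "e \<in> edges X" for e
  proof -
    obtain s where s: "s \<in> simplices T" "card s = 2" "e = code s" using e by (auto simp: surface_parts)
    then show ?thesis
      using card_above_edge[of s] T_sub card_code[of "{t \<in> T. s \<subseteq> t}"] unfolding surface_parts s(3)
      by (subst above) auto
  qed
  have star: "\<exists>v. v \<in> \<Union>T \<and> V = code {v} \<and> {F \<in> faces X. V \<triangleleft>\<^bsub>X\<^esub> F} = code ` {t \<in> T. v \<in> t}" if V: "V \<in> vertices X" for V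
  proof -
    obtain v where v: "{v} \<in> simplices T" "V = code {v}" using V by (auto simp: surface_parts card_1_singleton_iff)
    then show ?thesis unfolding surface_parts using above[OF T_sub v(1)] singleton_simplex above_vertex by auto
  qed
  show "finite {F \<in> faces X. V \<triangleleft>\<^bsub>X\<^esub> F}" for V
    using finite_T by (simp add: surface_parts)
  show "3 \<le> card {F \<in> faces X. V \<triangleleft>\<^bsub>X\<^esub> F}" if V: "V \<in> vertices X" for V
  proof -
    obtain v where v: "v \<in> \<Union>T" "{F \<in> faces X. V \<triangleleft>\<^bsub>X\<^esub> F} = code ` {t \<in> T. v \<in> t}" using star[OF V] by blast
    then obtain ts where "distinct ts" "set ts = {t \<in> T. v \<in> t}" "3 \<le> length ts" using umbrella_T by blast
    moreover have "card (code ` {t \<in> T. v \<in> t}) = card {t \<in> T. v \<in> t}" using T_sub by (intro card_code) auto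
    ultimately show ?thesis using v by (metis distinct_card)
  qed
  show "\<exists>Fs. distinct Fs \<and> set Fs = {F \<in> faces X. V \<triangleleft>\<^bsub>X\<^esub> F} \<and>
      (\<forall>i < length Fs. \<exists>e \<in> edges X. V \<triangleleft>\<^bsub>X\<^esub> e \<and> e \<triangleleft>\<^bsub>X\<^esub> Fs ! i \<and> e \<triangleleft>\<^bsub>X\<^esub> Fs ! (Suc i mod length Fs))"
    if V: "V \<in> vertices X" for V
  proof -
    obtain v where v: "v \<in> \<Union>T" "V = code {v}" "{F \<in> faces X. V \<triangleleft>\<^bsub>X\<^esub> F} = code ` {t \<in> T. v \<in> t}"
      using star[OF V] by blast
    then obtain ts where ts: "distinct ts" "set ts = {t \<in> T. v \<in> t}"
      "\<forall>i < length ts. card (ts ! i \<inter> ts ! (Suc i mod length ts)) = 2" using umbrella_T by blast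
    have "inj_on code (set ts)" using inj_on_subset[OF inj_code] T_sub ts(2) by (metis (no_types, lifting) mem_Collect_eq subset_eq)
    then have dist: "distinct (map code ts)" using ts(1) by (simp add: distinct_map)
    have share: "\<exists>e \<in> edges X. V \<triangleleft>\<^bsub>X\<^esub> e \<and> e \<triangleleft>\<^bsub>X\<^esub> code (ts ! i) \<and> e \<triangleleft>\<^bsub>X\<^esub> code (ts ! (Suc i mod length ts))"
      if i: "i < length ts" for i
    proof -
      let ?t = "ts ! i" and ?u = "ts ! (Suc i mod length ts)"
      have "Suc i mod length ts < length ts" using i by (intro mod_less_divisor) linarith
      then have tu: "?t \<in> T" "?u \<in> T" "v \<in> ?t \<inter> ?u" using i ts(2) nth_mem[of _ ts] by auto
      have c: "card (?t \<inter> ?u) = 2" using ts(3) i by blast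
      have "?t \<inter> ?u \<noteq> ?t" "?t \<inter> ?u \<noteq> ?u" "?t \<inter> ?u \<noteq> {v}"
        using c card_triangle tu by force+
      then have "?t \<inter> ?u \<subset> ?t" "?t \<inter> ?u \<subset> ?u" "{v} \<subset> ?t \<inter> ?u" using tu(3) by auto
      moreover have e: "?t \<inter> ?u \<in> simplices T" using tu by (auto simp: simplices_def)
      ultimately show ?thesis
        using incident_iff T_sub tu(1,2) c v singleton_simplex
        by (intro bexI[of _ "code (?t \<inter> ?u)"]) (auto simp: surface_parts)
    qed
    show ?thesis
    proof (rule exI[of _ "map code ts"], intro conjI allI impI)
      fix i assume "i < length (map code ts)"
      moreover from this have "Suc i mod length ts < length ts" by (intro mod_less_divisor) auto
      ultimately show "\<exists>e \<in> edges X. V \<triangleleft>\<^bsub>X\<^esub> e \<and> e \<triangleleft>\<^bsub>X\<^esub> map code ts ! i \<and>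
          e \<triangleleft>\<^bsub>X\<^esub> map code ts ! (Suc i mod length (map code ts))"
        using share by simp
    qed (use dist ts v(3) in auto)
  qed
qed

text \<open>The set of vertices below a simplex is the simplex itself, up to coding.\<close>

lemma vertex_faithful_X: "vertex_faithful X"
proof -
  have *: "{V \<in> vertices X. V \<triangleleft>\<^bsub>X\<^esub> code s \<or> V = code s} = code ` (\<lambda>v. {v}) ` s" if s: "s \<in> simplices T" for s
  proof -
    have "{V \<in> vertices X. V \<triangleleft>\<^bsub>X\<^esub> code s \<or> V = code s} = code ` {r \<in> simplices T. card r = 1 \<and> r \<subseteq> s}"
      using incident_iff[OF _ s] code_eq[OF _ s] unfolding surface_parts psubset_eq by blast
    also have "{r \<in> simplices T. card r = 1 \<and> r \<subseteq> s} = (\<lambda>v. {v}) ` s"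
      using simplex_mono[OF s] by (auto simp: card_1_singleton_iff)
    finally show ?thesis .
  qed
  have sub: "(\<lambda>v. {v}) ` s \<subseteq> simplices T" if "s \<in> simplices T" for s
    using simplex_mono[OF that] by auto
  have "s = t"
    if "s \<in> simplices T" "t \<in> simplices T"
      "{V \<in> vertices X. V \<triangleleft>\<^bsub>X\<^esub> code s \<or> V = code s} = {V \<in> vertices X. V \<triangleleft>\<^bsub>X\<^esub> code t \<or> V = code t}" for s t
  proof -
    have "(\<lambda>v. {v}) ` s = (\<lambda>v. {v}) ` t"
      using that inj_on_image_eq_iff[OF inj_code, of "(\<lambda>v. {v}) ` s" "(\<lambda>v. {v}) ` t"] * sub by simp
    then show ?thesis by blast
  qed
  then show ?thesis
    unfolding vertex_faithful_def elements_X inj_on_def by blast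
qed

lemma double_count: "2 * card (edges X) = 3 * card (faces X)"
proof -
  interpret simplicial_surface X by (rule simplicial_surface_X)
  have fin: "finite (edges X)" "finite (faces X)" using finite_T finite_simplices by (simp_all add: surface_parts)
  have "(\<Sum>e \<in> edges X. card {F \<in> faces X. e \<triangleleft>\<^bsub>X\<^esub> F}) = 3 * card (faces X)"
    using fin face_edges by (intro sum_multicount) auto
  then show ?thesis using edge_faces by simp
qed

lemma card_vertices: "card (vertices X) = card (\<Union>T)"
proof -
  have "{s \<in> simplices T. card s = 1} = (\<lambda>v. {v}) ` \<Union>T"
    using singleton_simplex by (auto simp: card_1_singleton_iff)
  moreover have "card (vertices X) = card {s \<in> simplices T. card s = 1}"
    unfolding surface_parts by (rule card_code) blast
  ultimately show ?thesis by (simp add: card_image)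
qed

lemma card_faces: "card (faces X) = card T"
  unfolding surface_parts using triangle_simplex by (intro card_code) blast

text \<open>As three edges bound a triangle and two triangles meet in an edge, \<open>2 |X\<^sub>1| = 3 |X\<^sub>2|\<close>. This turns the
  Euler characteristic condition into \<open>|X\<^sub>2| + 4 = 2 |X\<^sub>0|\<close>. For connectedness it suffices that every vertex can
  be reached from a fixed vertex \<open>h\<close> along edges.\<close>

lemma simplicial_sphere_X:
  assumes hub: "\<And>v. v \<in> \<Union>T \<Longrightarrow> (h, v) \<in> {(u, v). {u, v} \<in> simplices T}\<^sup>*"
    and euler: "card T + 4 = 2 * card (\<Union>T)"
  shows "simplicial_sphere X"
proof -
  define R where "R = {(C, D). C \<triangleleft>\<^bsub>X\<^esub> D \<or> D \<triangleleft>\<^bsub>X\<^esub> C}"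
  have sym: "sym (R\<^sup>*)" by (rule sym_rtrancl) (auto simp: sym_def R_def)
  have sub: "(code r, code s) \<in> R\<^sup>*" if "r \<in> simplices T" "s \<in> simplices T" "r \<subseteq> s" for r s
    using that incident_iff[of r s] by (cases "r = s") (auto simp: R_def psubset_eq)
  have step: "(code {u}, code {v}) \<in> R\<^sup>*" if "{u, v} \<in> simplices T" for u v
  proof -
    have "{u} \<in> simplices T" "{v} \<in> simplices T" using that by (auto intro: simplex_mono)
    then have "(code {u}, code {u, v}) \<in> R\<^sup>*" "(code {v}, code {u, v}) \<in> R\<^sup>*" using that by (auto intro: sub)
    then show ?thesis using sym by (metis rtrancl_trans symD)
  qed
  have reach: "(code {h}, code {v}) \<in> R\<^sup>*" if "v \<in> \<Union>T" for v
    using hub[OF that] by (induction rule: rtrancl_induct) (auto intro: rtrancl_trans step)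
  have "(code {h}, A) \<in> R\<^sup>*" if A: "A \<in> elements X" for A
  proof -
    obtain s where s: "s \<in> simplices T" "A = code s" using A by (auto simp: elements_X)
    then obtain v where v: "v \<in> s" by (auto simp: simplices_def)
    then have "{v} \<in> simplices T" using s by (auto intro: simplex_mono)
    then show ?thesis using reach[of v] sub[of "{v}" s] s v singleton_simplex by (auto intro: rtrancl_trans)
  qed
  then have "surface_connected X"
    unfolding surface_connected_def R_def[symmetric] using sym by (metis rtrancl_trans symD)
  moreover have "euler_characteristic X = 2"
    using double_count euler by (simp add: euler_characteristic_def card_vertices card_faces)
  ultimately show ?thesis
    using simplicial_surface_X finite_simplices by (simp add: simplicial_sphere_def elements_X)
qed

lemma induced_code: "s \<in> simplices T \<Longrightarrow> induced code T g (code s) = code (g ` s)"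
  by (simp add: induced_def inj_code)

lemma induced_simplices:
  assumes "\<And>t. t \<in> T \<Longrightarrow> g ` t \<in> T" "s \<in> simplices T"
  shows "g ` s \<in> simplices T"
  using assms by (fastforce simp: simplices_def)

lemma induced_in_Aut:
  assumes g: "inj_on g (\<Union>T)" "\<And>t. t \<in> T \<Longrightarrow> g ` t \<in> T"
  shows "induced code T g \<in> carrier (Aut X)"
proof -
  note im = induced_simplices[OF g(2)]
  have sub: "s \<subseteq> \<Union>T" if "s \<in> simplices T" for s using that by (auto simp: simplices_def)
  have "inj_on (induced code T g) (elements X)"
    unfolding elements_X
  proof (rule inj_onI, elim imageE)
    fix x y s t assume *: "induced code T g x = induced code T g y" "x = code s" "y = code t"
      "s \<in> simplices T" "t \<in> simplices T"
    then have "g ` s = g ` t" using code_eq im by (simp add: induced_code)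
    then have "s = t" using inj_on_image_eq_iff[OF g(1) sub sub] * by blast
    then show "x = y" using * by simp
  qed
  moreover have maps: "induced code T g ` elements X \<subseteq> elements X"
    using im by (auto simp: elements_X induced_code)
  ultimately have "bij_betw (induced code T g) (elements X) (elements X)"
    using finite_simplices by (simp add: bij_betw_def endo_inj_surj elements_X)
  then have "induced code T g \<in> Bij (elements X)"
    by (simp add: Bij_def elements_X induced_def)
  moreover have "code s \<triangleleft>\<^bsub>X\<^esub> code t \<longleftrightarrow> induced code T g (code s) \<triangleleft>\<^bsub>X\<^esub> induced code T g (code t)"
    if st: "s \<in> simplices T" "t \<in> simplices T" for s t
  proof -
    have "s \<subseteq> t" if "g ` s \<subseteq> g ` t"
    proof
      fix x assume x: "x \<in> s"
      then have "g x \<in> g ` t" using that by blast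
      then show "x \<in> t" using inj_on_image_mem_iff[OF g(1) _ sub[OF st(2)]] x sub[OF st(1)] by blast
    qed
    then have "s \<subseteq> t \<longleftrightarrow> g ` s \<subseteq> g ` t" by blast
    then have "s \<subset> t \<longleftrightarrow> g ` s \<subset> g ` t"
      using inj_on_image_eq_iff[OF g(1) sub[OF st(1)] sub[OF st(2)]] by (simp add: psubset_eq)
    then show ?thesis using st im by (simp add: induced_code incident_iff)
  qed
  ultimately show ?thesis
    unfolding carrier_Aut[OF simplicial_surface_X] by (auto simp: elements_X)
qed

text \<open>An automorphism is an automorphism of the poset of simplices. It permutes the minimal elements, which
  are the singletons, and this gives the vertex map \<open>g\<close>. A simplex is determined by the
  singletons below it, so the automorphism is the one induced by \<open>g\<close>.\<close>

lemma Aut_induced: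
  assumes "\<pi> \<in> carrier (Aut X)"
  obtains g where "inj_on g (\<Union>T)" "\<And>t. t \<in> T \<Longrightarrow> g ` t \<in> T" "\<pi> = induced code T g"
proof -
  have \<pi>: "\<pi> \<in> Bij (elements X)"
    and inc: "\<And>A B. \<lbrakk>A \<in> elements X; B \<in> elements X\<rbrakk> \<Longrightarrow> A \<triangleleft>\<^bsub>X\<^esub> B \<longleftrightarrow> \<pi> A \<triangleleft>\<^bsub>X\<^esub> \<pi> B"
    using assms unfolding carrier_Aut[OF simplicial_surface_X] by auto
  have bij: "bij_betw \<pi> (elements X) (elements X)" using \<pi> by (simp add: Bij_def)
  \<comment> \<open>The automorphism as a map of simplices.\<close>
  define \<rho> where "\<rho> s = inv_into (simplices T) code (\<pi> (code s))" for s
  have \<rho>: "\<rho> s \<in> simplices T" "code (\<rho> s) = \<pi> (code s)" if "s \<in> simplices T" for s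
  proof -
    have "\<pi> (code s) \<in> code ` simplices T" using bij that bij_betw_apply unfolding elements_X by fastforce
    then show "\<rho> s \<in> simplices T" "code (\<rho> s) = \<pi> (code s)"
      unfolding \<rho>_def by (auto intro: inv_into_into f_inv_into_f)
  qed
  have mono: "\<rho> r \<subset> \<rho> s \<longleftrightarrow> r \<subset> s" if "r \<in> simplices T" "s \<in> simplices T" for r s
    using that inc[of "code r" "code s"] \<rho> incident_iff by (metis elements_X imageI)
  have surj: "\<exists>r \<in> simplices T. \<rho> r = s" if "s \<in> simplices T" for s
  proof -
    have "code s \<in> \<pi> ` elements X" using bij_betw_imp_surj_on[OF bij] that elements_X by blast
    then obtain r where r: "r \<in> simplices T" "\<pi> (code r) = code s" unfolding elements_X by auto
    then have "\<rho> r = s" using \<rho>[OF r(1)] code_eq[OF _ that] by simp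
    then show ?thesis using r by blast
  qed
  have inj: "r = s" if "\<rho> r = \<rho> s" "r \<in> simplices T" "s \<in> simplices T" for r s
    using that \<rho>(2) bij code_eq by (metis bij_betw_imp_inj_on elements_X imageI inj_on_eq_iff)
  have minimal: "(\<exists>v. s = {v}) \<longleftrightarrow> (\<forall>r \<in> simplices T. \<not> r \<subset> s)" if s: "s \<in> simplices T" for s
  proof
    assume "\<exists>v. s = {v}"
    then show "\<forall>r \<in> simplices T. \<not> r \<subset> s" by (auto simp: simplices_def)
  next
    assume *: "\<forall>r \<in> simplices T. \<not> r \<subset> s"
    obtain v where "v \<in> s" using s by (auto simp: simplices_def)
    then have "{v} \<in> simplices T" "{v} \<subseteq> s" using simplex_mono[OF s, of "{v}"] by auto
    then show "\<exists>v. s = {v}" using * by blast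
  qed
  have single: "(\<exists>w. \<rho> s = {w}) \<longleftrightarrow> (\<exists>v. s = {v})" if "s \<in> simplices T" for s
    using minimal[OF that] minimal[OF \<rho>(1)[OF that]] mono surj \<rho>(1) that by metis
  define g where "g v = (THE w. \<rho> {v} = {w})" for v
  have g: "\<rho> {v} = {g v}" if "v \<in> \<Union>T" for v
  proof -
    have "\<exists>w. \<rho> {v} = {w}" using that singleton_simplex single by blast
    then show ?thesis by (auto simp: g_def)
  qed
  have weak: "\<rho> r \<subseteq> \<rho> s \<longleftrightarrow> r \<subseteq> s" if "r \<in> simplices T" "s \<in> simplices T" for r s
    using mono that inj by (metis psubset_eq order_refl)
  have image: "\<rho> s = g ` s" if s: "s \<in> simplices T" for s
  proof (intro subset_antisym subsetI)
    fix w assume w: "w \<in> \<rho> s"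
    then have w': "{w} \<in> simplices T" using simplex_mono[OF \<rho>(1)[OF s], of "{w}"] by auto
    then obtain r where r: "r \<in> simplices T" "\<rho> r = {w}" using surj by blast
    then obtain v where v: "r = {v}" using single by blast
    then have "v \<in> \<Union>T" using r singleton_simplex by blast
    then show "w \<in> g ` s" using g[of v] r v w weak[OF r(1) s] by auto
  next
    fix w assume "w \<in> g ` s"
    then obtain v where v: "v \<in> s" "w = g v" by blast
    then have "{v} \<in> simplices T" using simplex_mono[OF s, of "{v}"] by auto
    then show "w \<in> \<rho> s" using weak[of "{v}" s] s g[of v] v singleton_simplex by auto
  qed
  have inj_g: "inj_on g (\<Union>T)"
    using g inj singleton_simplex by (intro inj_onI) (metis singleton_inject)
  show thesis
  proof (rule that[of g])
    show "inj_on g (\<Union>T)" by (rule inj_g)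
    show "g ` t \<in> T" if t: "t \<in> T" for t
    proof -
      have "card (g ` t) = 3" using card_triangle[OF t] inj_on_subset[OF inj_g] t by (metis Union_upper card_image)
      then show ?thesis using triangle_iff \<rho>(1) image triangle_simplex[OF t] by metis
    qed
    show "\<pi> = induced code T g"
    proof (rule extensionalityI[of _ "elements X"])
      show "\<pi> \<in> extensional (elements X)" using \<pi> by (simp add: Bij_def)
      show "induced code T g \<in> extensional (elements X)" by (simp add: induced_def elements_X)
      show "\<pi> x = induced code T g x" if "x \<in> elements X" for x
        using that \<rho>(2) image by (auto simp: elements_X induced_code)
    qed
  qed
qed

lemma mult_induced:
  assumes "inj_on g (\<Union>T)" "\<And>t. t \<in> T \<Longrightarrow> g ` t \<in> T" "inj_on h (\<Union>T)" "\<And>t. t \<in> T \<Longrightarrow> h ` t \<in> T"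
  shows "induced code T g \<otimes>\<^bsub>Aut X\<^esub> induced code T h = induced code T (g \<circ> h)"
proof -
  have "induced code T g \<in> Bij (elements X)" "induced code T h \<in> Bij (elements X)"
    using induced_in_Aut assms unfolding carrier_Aut[OF simplicial_surface_X] by auto
  then have "induced code T g \<otimes>\<^bsub>Aut X\<^esub> induced code T h = compose (elements X) (induced code T g) (induced code T h)"
    by (simp add: Aut_def BijGroup_def)
  also have "\<dots> = induced code T (g \<circ> h)"
  proof (rule extensionalityI[of _ "elements X"])
    show "compose (elements X) (induced code T g) (induced code T h) x = induced code T (g \<circ> h) x" if "x \<in> elements X" for x
      using that induced_simplices[of h] assms(4) by (auto simp: elements_X compose_def induced_code image_comp)
  qed (simp_all add: induced_def elements_X)
  finally show ?thesis .
qed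

lemma induced_eq_iff:
  assumes "\<And>t. t \<in> T \<Longrightarrow> g ` t \<in> T" "\<And>t. t \<in> T \<Longrightarrow> h ` t \<in> T"
  shows "induced code T g = induced code T h \<longleftrightarrow> (\<forall>v \<in> \<Union>T. g v = h v)"
proof
  assume eq: "induced code T g = induced code T h"
  show "\<forall>v \<in> \<Union>T. g v = h v"
  proof
    fix v assume "v \<in> \<Union>T"
    then have v: "{v} \<in> simplices T" using singleton_simplex by blast
    then have "code (g ` {v}) = code (h ` {v})" using eq induced_code by metis
    then have "g ` {v} = h ` {v}"
      using code_eq[OF induced_simplices[of g] induced_simplices[of h]] assms v by blast
    then show "g v = h v" by simp
  qed
next
  assume eq: "\<forall>v \<in> \<Union>T. g v = h v"
  show "induced code T g = induced code T h"
  proof (rule extensionalityI[of _ "elements X"])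
    fix x assume "x \<in> elements X"
    then obtain s where s: "s \<in> simplices T" "x = code s" by (auto simp: elements_X)
    then have "s \<subseteq> \<Union>T" by (auto simp: simplices_def)
    then have "g v = h v" if "v \<in> s" for v using that eq by blast
    then have "g ` s = h ` s" by (rule image_cong[OF refl])
    then show "induced code T g x = induced code T h x" using s by (simp add: induced_code)
  qed (simp_all add: induced_def elements_X)
qed

end

section \<open>The subdivided double pyramid\<close>

text \<open>The corners of the sphere correspond to the regions of the drawing of \<open>\<Gamma>\<^sub>D\<close>: \<open>Apex\<close> to the one bounded
  by the \<open>d\<^sub>i\<close>, \<open>Base\<close> to the one bounded by the \<open>a\<^sub>i\<close> and \<open>b\<^sub>i\<close>, \<open>Tip k\<close> to the
  triangle \<open>a\<^sub>k b\<^sub>k c\<^sub>k\<close>, and \<open>Rim k\<close> to the hexagon between columns \<open>k - 1\<close> and \<open>k\<close>. Geometrically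
  the sphere is the double pyramid over an \<open>n\<close>-gon with corners \<open>Rim k\<close>, where the lower face at
  \<open>Rim k\<close> and \<open>Rim (k + 1)\<close> is subdivided by the additional corner \<open>Tip k\<close>.\<close>

datatype corner = Apex | Base | Rim nat | Tip nat

fun triangle :: "nat \<Rightarrow> gamma_node \<Rightarrow> corner set" where
  "triangle n (av k) = {Tip k, Rim (nxt n k), Base}"
| "triangle n (bv k) = {Tip k, Rim k, Base}"
| "triangle n (cv k) = {Tip k, Rim k, Rim (nxt n k)}"
| "triangle n (dv k) = {Apex, Rim k, Rim (nxt n k)}"

definition triangles :: "nat \<Rightarrow> corner set set" where
  "triangles n = triangle n ` nodes (Gamma_D n)"

lemma nxt_inject: "\<lbrakk>j \<in> {1..n}; k \<in> {1..n}\<rbrakk> \<Longrightarrow> nxt n j = nxt n k \<longleftrightarrow> j = k"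
  by (metis prv_nxt)

lemma node_cases [consumes 1, case_names a b c d]:
  assumes "v \<in> nodes (Gamma_D n)"
  obtains k where "k \<in> {1..n}" "v = av k" | k where "k \<in> {1..n}" "v = bv k"
    | k where "k \<in> {1..n}" "v = cv k" | k where "k \<in> {1..n}" "v = dv k"
  using assms unfolding nodes_Gamma by auto

lemma node_mem:
  "av k \<in> nodes (Gamma_D n) \<longleftrightarrow> k \<in> {1..n}" "bv k \<in> nodes (Gamma_D n) \<longleftrightarrow> k \<in> {1..n}"
  "cv k \<in> nodes (Gamma_D n) \<longleftrightarrow> k \<in> {1..n}" "dv k \<in> nodes (Gamma_D n) \<longleftrightarrow> k \<in> {1..n}"
  by (auto simp: nodes_Gamma)

lemma node_set_eqI:
  assumes "\<And>k. k \<in> {1..n} \<Longrightarrow> P (av k) \<longleftrightarrow> av k \<in> A" "\<And>k. k \<in> {1..n} \<Longrightarrow> P (bv k) \<longleftrightarrow> bv k \<in> A"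
    "\<And>k. k \<in> {1..n} \<Longrightarrow> P (cv k) \<longleftrightarrow> cv k \<in> A" "\<And>k. k \<in> {1..n} \<Longrightarrow> P (dv k) \<longleftrightarrow> dv k \<in> A"
    "A \<subseteq> nodes (Gamma_D n)"
  shows "{v \<in> nodes (Gamma_D n). P v} = A"
proof -
  have "P v \<longleftrightarrow> v \<in> A" if "v \<in> nodes (Gamma_D n)" for v
    using that assms(1-4) by (cases rule: node_cases) auto
  then show ?thesis using assms(5) by blast
qed

context
  fixes n :: nat
  assumes n: "n > 2"
begin

lemma card_triangle_D:
  assumes "v \<in> nodes (Gamma_D n)"
  shows "card (triangle n v) = 3"
  using assms nxt_neq[of n, symmetric] n by (cases rule: node_cases) (auto simp: card_insert_if)

text \<open>For each of the six kinds of edges of the sphere, the two triangles that contain it. In each case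
  they are joined by a link of the graph, and all links arise. Thus this table shows both that edges lie
  in two triangles and that the face graph is the given one.\<close>

lemma star_pair:
  assumes k: "k \<in> {1..n}"
  shows "{v \<in> nodes (Gamma_D n). {Tip k, Base} \<subseteq> triangle n v} = {av k, bv k}"
    and "{v \<in> nodes (Gamma_D n). {Tip k, Rim (nxt n k)} \<subseteq> triangle n v} = {av k, cv k}"
    and "{v \<in> nodes (Gamma_D n). {Rim k, Rim (nxt n k)} \<subseteq> triangle n v} = {cv k, dv k}"
    and "{v \<in> nodes (Gamma_D n). {Tip k, Rim k} \<subseteq> triangle n v} = {bv k, cv k}"
    and "{v \<in> nodes (Gamma_D n). {Rim (nxt n k), Base} \<subseteq> triangle n v} = {av k, bv (nxt n k)}"
    and "{v \<in> nodes (Gamma_D n). {Apex, Rim (nxt n k)} \<subseteq> triangle n v} = {dv k, dv (nxt n k)}"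
proof -
  have *: "nxt n k \<in> {1..n}" "nxt n k \<noteq> k" "nxt n (nxt n k) \<noteq> k"
    using nxt_mem[OF k] nxt_neq[OF _ k] nxt_nxt_neq[OF n k] n by auto
  have inj: "nxt n k = nxt n i \<longleftrightarrow> i = k" if "i \<in> {1..n}" for i using nxt_inject k that by metis
  have range: "1 \<le> k" "k \<le> n" "1 \<le> nxt n k" "nxt n k \<le> n" using *(1) k by auto
  note inj = inj[simplified]
  show "{v \<in> nodes (Gamma_D n). {Tip k, Base} \<subseteq> triangle n v} = {av k, bv k}"
    by (rule node_set_eqI; simp add: node_mem range[simplified]; (metis *(2,3) inj)?)
  show "{v \<in> nodes (Gamma_D n). {Tip k, Rim (nxt n k)} \<subseteq> triangle n v} = {av k, cv k}"
    by (rule node_set_eqI; simp add: node_mem range[simplified]; (metis *(2,3) inj)?)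
  show "{v \<in> nodes (Gamma_D n). {Rim k, Rim (nxt n k)} \<subseteq> triangle n v} = {cv k, dv k}"
    by (rule node_set_eqI; simp add: node_mem range[simplified]; (metis *(2,3) inj)?)
  show "{v \<in> nodes (Gamma_D n). {Tip k, Rim k} \<subseteq> triangle n v} = {bv k, cv k}"
    by (rule node_set_eqI; simp add: node_mem range[simplified]; (metis *(2,3) inj)?)
  show "{v \<in> nodes (Gamma_D n). {Rim (nxt n k), Base} \<subseteq> triangle n v} = {av k, bv (nxt n k)}"
    by (rule node_set_eqI; simp add: node_mem range[simplified]; (metis *(2,3) inj)?)
  show "{v \<in> nodes (Gamma_D n). {Apex, Rim (nxt n k)} \<subseteq> triangle n v} = {dv k, dv (nxt n k)}"
    by (rule node_set_eqI; simp add: node_mem range[simplified]; (metis *(2,3) inj)?)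
qed

lemma link_edge:
  assumes "l \<in> links (Gamma_D n)"
  obtains e where "card e = 2" "{v \<in> nodes (Gamma_D n). e \<subseteq> triangle n v} = l"
proof -
  have "\<exists>e. card e = 2 \<and> {v \<in> nodes (Gamma_D n). e \<subseteq> triangle n v} = l"
  proof -
    have 1: "1 \<le> n" using n by simp
    from assms 1 show ?thesis
    proof (cases rule: link_cases)
      case (ab k)
      then show ?thesis using star_pair(1)[of k] by (intro exI[of _ "{Tip k, Base}"]) simp
    next
      case (ac k)
      then show ?thesis using star_pair(2)[of k] by (intro exI[of _ "{Tip k, Rim (nxt n k)}"]) simp
    next
      case (cd k)
      then show ?thesis using star_pair(3)[of k] nxt_neq[of n k] n
        by (intro exI[of _ "{Rim k, Rim (nxt n k)}"]) (simp add: card_insert_if)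
    next
      case (bc k)
      then show ?thesis using star_pair(4)[of k] by (intro exI[of _ "{Tip k, Rim k}"]) simp
    next
      case (a_next k)
      then show ?thesis using star_pair(5)[of k] by (intro exI[of _ "{Rim (nxt n k), Base}"]) simp
    next
      case (d_next k)
      then show ?thesis using star_pair(6)[of k] by (intro exI[of _ "{Apex, Rim (nxt n k)}"]) simp
    qed
  qed
  then show thesis using that by blast
qed

lemma pair_in_triple:
  assumes "e \<subseteq> {x, y, z}" "card e = 2"
  shows "e = {x, y} \<or> e = {x, z} \<or> e = {y, z}"
proof -
  obtain p q where "e = {p, q}" "p \<noteq> q" using assms(2) by (auto simp: card_2_iff)
  then show ?thesis using assms(1) by auto
qed

lemma edge_link:
  assumes v: "v \<in> nodes (Gamma_D n)" and e: "e \<subseteq> triangle n v" "card e = 2"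
  shows "{w \<in> nodes (Gamma_D n). e \<subseteq> triangle n w} \<in> links (Gamma_D n)"
  using v
proof (cases rule: node_cases)
  case (a k)
  then have "e = {Tip k, Rim (nxt n k)} \<or> e = {Tip k, Base} \<or> e = {Rim (nxt n k), Base}"
    using e by (intro pair_in_triple) auto
  then show ?thesis
    using star_pair[OF a(1)] link_mem[OF a(1)] by (elim disjE) simp_all
next
  case (b k)
  then have "e = {Tip k, Rim k} \<or> e = {Tip k, Base} \<or> e = {Rim k, Base}"
    using e by (intro pair_in_triple) auto
  then show ?thesis
    using star_pair[OF b(1)] link_mem[OF b(1)] star_pair(5)[OF prv_mem[OF b(1)], unfolded nxt_prv[OF b(1)]]
      link_mem(5)[OF prv_mem[OF b(1)], unfolded nxt_prv[OF b(1)]] by (elim disjE) simp_all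
next
  case (c k)
  then have "e = {Tip k, Rim k} \<or> e = {Tip k, Rim (nxt n k)} \<or> e = {Rim k, Rim (nxt n k)}"
    using e by (intro pair_in_triple) auto
  then show ?thesis
    using star_pair[OF c(1)] link_mem[OF c(1)] by (elim disjE) simp_all
next
  case (d k)
  then have "e = {Apex, Rim k} \<or> e = {Apex, Rim (nxt n k)} \<or> e = {Rim k, Rim (nxt n k)}"
    using e by (intro pair_in_triple) auto
  then show ?thesis
    using star_pair[OF d(1)] link_mem[OF d(1)] star_pair(6)[OF prv_mem[OF d(1)], unfolded nxt_prv[OF d(1)]]
      link_mem(6)[OF prv_mem[OF d(1)], unfolded nxt_prv[OF d(1)]] by (elim disjE) simp_all
qed

lemma inj_triangle: "inj_on (triangle n) (nodes (Gamma_D n))"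
proof (rule inj_onI)
  fix u v assume u: "u \<in> nodes (Gamma_D n)" and v: "v \<in> nodes (Gamma_D n)" and eq: "triangle n u = triangle n v"
  have in_star: "v \<in> A" if "{v \<in> nodes (Gamma_D n). e \<subseteq> triangle n v} = A" "e \<subseteq> triangle n u" for e A
    using that v eq by blast
  from u show "u = v"
  proof (cases rule: node_cases)
    case (a k)
    then show ?thesis using in_star[OF star_pair(1)[OF a(1)]] in_star[OF star_pair(2)[OF a(1)]] by auto
  next
    case (b k)
    then show ?thesis using in_star[OF star_pair(1)[OF b(1)]] in_star[OF star_pair(4)[OF b(1)]] by auto
  next
    case (c k)
    then show ?thesis using in_star[OF star_pair(2)[OF c(1)]] in_star[OF star_pair(4)[OF c(1)]] by auto
  next
    case (d k)
    then show ?thesis using in_star[OF star_pair(3)[OF d(1)]] in_star[OF star_pair(6)[OF d(1)]] by auto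
  qed
qed

lemma star_as_image: "{t \<in> triangles n. s \<subseteq> t} = triangle n ` {v \<in> nodes (Gamma_D n). s \<subseteq> triangle n v}"
  by (auto simp: triangles_def)

lemma card_star:
  "card {t \<in> triangles n. s \<subseteq> t} = card {v \<in> nodes (Gamma_D n). s \<subseteq> triangle n v}"
  unfolding star_as_image by (intro card_image inj_on_subset[OF inj_triangle]) blast

lemma card_link: "l \<in> links (Gamma_D n) \<Longrightarrow> card l = 2"
  using graph_Gamma[of n] n by (simp add: graph_def)

lemma adjacent_triangles:
  assumes "{u, v} \<in> links (Gamma_D n)"
  shows "card (triangle n u \<inter> triangle n v) = 2"
proof -
  obtain e where e: "card e = 2" "{v \<in> nodes (Gamma_D n). e \<subseteq> triangle n v} = {u, v}"
    using link_edge[OF assms] by blast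
  then have uv: "u \<in> nodes (Gamma_D n)" "v \<in> nodes (Gamma_D n)" "e \<subseteq> triangle n u \<inter> triangle n v" by blast+
  have "u \<noteq> v" using card_link[OF assms] by auto
  then have neq: "triangle n u \<noteq> triangle n v" using inj_triangle uv by (auto dest: inj_onD)
  have c: "card (triangle n u) = 3" "card (triangle n v) = 3" using card_triangle_D uv by auto
  then have fin: "finite (triangle n u)" "finite (triangle n v)" using card.infinite by fastforce+
  have "\<not> triangle n u \<subseteq> triangle n v" using neq c fin card_subset_eq by metis
  then have "card (triangle n u \<inter> triangle n v) < 3"
    using psubset_card_mono[of "triangle n u" "triangle n u \<inter> triangle n v"] fin c by auto
  moreover have "2 \<le> card (triangle n u \<inter> triangle n v)"
    using card_mono[OF _ uv(3)] fin e by auto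
  ultimately show ?thesis by simp
qed

text \<open>The triangles around a corner are arranged as the boundary cycle of the corresponding region.\<close>

definition face_cycle :: "gamma_node list \<Rightarrow> bool" where
  "face_cycle vs \<longleftrightarrow> distinct vs \<and> (\<forall>i < length vs. {vs ! i, vs ! (Suc i mod length vs)} \<in> links (Gamma_D n))"

lemma face_cycleI:
  assumes "distinct vs" "\<forall>(u, v) \<in> set (zip vs (rotate1 vs)). {u, v} \<in> links (Gamma_D n)"
  shows "face_cycle vs"
  using assms unfolding face_cycle_def set_zip by (fastforce simp: nth_rotate1)

lemma link_swap: "{x, y} \<in> links (Gamma_D n) \<Longrightarrow> {y, x} \<in> links (Gamma_D n)"
  by (simp add: insert_commute)

lemma vertex_star_Tip:
  assumes "k \<in> {1..n}"
  shows "{v \<in> nodes (Gamma_D n). Tip k \<in> triangle n v} = set [av k, bv k, cv k]"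
    and "face_cycle [av k, bv k, cv k]"
proof -
  show "{v \<in> nodes (Gamma_D n). Tip k \<in> triangle n v} = set [av k, bv k, cv k]"
    by (rule node_set_eqI) (use assms node_mem in auto)
  show "face_cycle [av k, bv k, cv k]"
    using link_mem[OF assms] link_mem[OF assms, THEN link_swap]
    by (intro face_cycleI) simp_all
qed

lemma vertex_star_Rim:
  assumes j: "j \<in> {1..n}" and k: "k = nxt n j"
  shows "{v \<in> nodes (Gamma_D n). Rim k \<in> triangle n v} = set [dv j, dv k, cv k, bv k, av j, cv j]"
    and "face_cycle [dv j, dv k, cv k, bv k, av j, cv j]"
proof -
  have k': "k \<in> {1..n}" "j \<noteq> k" using nxt_mem[OF j] nxt_neq[OF _ j] n k by auto
  have inj: "k = nxt n i \<longleftrightarrow> i = j" if "i \<in> {1..n}" for i using nxt_inject j that k by metis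
  show "{v \<in> nodes (Gamma_D n). Rim k \<in> triangle n v} = set [dv j, dv k, cv k, bv k, av j, cv j]"
    by (rule node_set_eqI) (use k' j in \<open>auto simp: node_mem inj\<close>)
  show "face_cycle [dv j, dv k, cv k, bv k, av j, cv j]"
    using link_mem[OF j, folded k] link_mem[OF k'(1)] link_mem[OF j, folded k, THEN link_swap]
      link_mem[OF k'(1), THEN link_swap] k'(2)
    by (intro face_cycleI) simp_all
qed

lemma vertex_star_Apex:
  "{v \<in> nodes (Gamma_D n). Apex \<in> triangle n v} = set (map dv [1..<Suc n])"
  "face_cycle (map dv [1..<Suc n])"
proof -
  show "{v \<in> nodes (Gamma_D n). Apex \<in> triangle n v} = set (map dv [1..<Suc n])"
    by (rule node_set_eqI) (use node_mem in auto)
  have "{dv (Suc i), dv (Suc (Suc i mod n))} \<in> links (Gamma_D n)" if "i < n" for i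
  proof -
    have "Suc (Suc i mod n) = nxt n (Suc i)" using that by (auto simp: nxt_def)
    then show ?thesis using link_mem(6)[of "Suc i" n] that by simp
  qed
  moreover have "Suc i mod n < n" for i using n by (intro mod_less_divisor) simp
  ultimately show "face_cycle (map dv [1..<Suc n])"
    by (simp add: face_cycle_def distinct_map inj_on_def del: upt_Suc)
qed

text \<open>The cycle \<open>b\<^sub>1 a\<^sub>1 b\<^sub>2 a\<^sub>2 \<dots> b\<^sub>n a\<^sub>n\<close>.\<close>

definition base_cycle :: "gamma_node list" where
  "base_cycle = map (\<lambda>i. if even i then bv (i div 2 + 1) else av (i div 2 + 1)) [0..<2 * n]"

lemma length_base_cycle: "length base_cycle = 2 * n"
  by (simp add: base_cycle_def)

lemma vertex_star_Base:
  "{v \<in> nodes (Gamma_D n). Base \<in> triangle n v} = set base_cycle"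
  "face_cycle base_cycle"
proof -
  define w where "w i = (if even i then bv (i div 2 + 1) else av (i div 2 + 1))" for i
  have cycle: "base_cycle = map w [0..<2 * n]" by (simp add: base_cycle_def w_def)
  have w_at: "w (2 * i) = bv (i + 1)" "w (2 * i + 1) = av (i + 1)" for i by (simp_all add: w_def)
  have "bv k \<in> w ` {0..<2 * n}" "av k \<in> w ` {0..<2 * n}" if "k \<in> {1..n}" for k
  proof -
    have "bv k = w (2 * (k - 1))" "av k = w (2 * (k - 1) + 1)" unfolding w_at using that by simp_all
    moreover have "2 * (k - 1) \<in> {0..<2 * n}" "2 * (k - 1) + 1 \<in> {0..<2 * n}" using that by auto
    ultimately show "bv k \<in> w ` {0..<2 * n}" "av k \<in> w ` {0..<2 * n}" by (blast intro: image_eqI)+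
  qed
  then have "av ` {1..n} \<union> bv ` {1..n} \<subseteq> w ` {0..<2 * n}" by (intro Un_least image_subsetI)
  moreover have "w ` {0..<2 * n} \<subseteq> av ` {1..n} \<union> bv ` {1..n}" by (auto simp: w_def)
  moreover have "{v \<in> nodes (Gamma_D n). Base \<in> triangle n v} = av ` {1..n} \<union> bv ` {1..n}"
    by (auto simp: nodes_Gamma)
  ultimately show "{v \<in> nodes (Gamma_D n). Base \<in> triangle n v} = set base_cycle"
    unfolding cycle set_map set_upt by (simp only: subset_antisym)
  have "inj w"
    by (rule inj_on_inverseI[where g = "\<lambda>v. case v of bv k \<Rightarrow> 2 * (k - 1) | av k \<Rightarrow> 2 * (k - 1) + 1 | _ \<Rightarrow> 0"])
      (simp add: w_def)
  moreover have "{w i, w (Suc i mod (2 * n))} \<in> links (Gamma_D n)" if i: "i < 2 * n" for i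
  proof (cases "even i")
    case True
    then obtain q where q: "i = 2 * q" by (elim evenE)
    then have "Suc i mod (2 * n) = 2 * q + 1" using i by simp
    then show ?thesis using link_mem(1)[of "q + 1" n] i q w_at[of q] by (simp add: insert_commute)
  next
    case False
    then obtain q where q: "i = 2 * q + 1" by (elim oddE)
    have "w (Suc i mod (2 * n)) = bv (nxt n (q + 1))"
    proof (cases "q + 1 = n")
      case True
      then have "Suc i = 2 * n" using q by simp
      then show ?thesis using True w_at(1)[of 0] by (simp add: nxt_def)
    next
      case False
      then have "Suc i mod (2 * n) = 2 * (q + 1)" using i q by simp
      then show ?thesis using False w_at(1)[of "q + 1"] by (simp add: nxt_def)
    qed
    then show ?thesis using link_mem(5)[of "q + 1" n] i q w_at(2)[of q] by simp
  qed
  moreover have "Suc i mod (2 * n) < 2 * n" for i using n by (intro mod_less_divisor) simp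
  ultimately show "face_cycle base_cycle"
    unfolding cycle by (simp add: face_cycle_def distinct_map inj_on_def inj_def)
qed

lemma corners: "\<Union>(triangles n) = {Apex, Base} \<union> Rim ` {1..n} \<union> Tip ` {1..n}"
proof -
  have "triangle n v \<subseteq> {Apex, Base} \<union> Rim ` {1..n} \<union> Tip ` {1..n}" if "v \<in> nodes (Gamma_D n)" for v
    using that nxt_mem[of _ n] by (cases rule: node_cases) auto
  then have "\<Union>(triangles n) \<subseteq> {Apex, Base} \<union> Rim ` {1..n} \<union> Tip ` {1..n}" unfolding triangles_def by blast
  moreover have mem: "triangle n (bv k) \<subseteq> \<Union>(triangles n)" "triangle n (dv k) \<subseteq> \<Union>(triangles n)" if "k \<in> {1..n}" for k
    unfolding triangles_def by (rule Union_upper, rule imageI, use that node_mem in blast)+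
  then have "Rim k \<in> \<Union>(triangles n)" "Tip k \<in> \<Union>(triangles n)" if "k \<in> {1..n}" for k
    using that by simp_all
  moreover have "Apex \<in> \<Union>(triangles n)" "Base \<in> \<Union>(triangles n)" using mem[of 1] n by simp_all
  ultimately show ?thesis by (intro subset_antisym Un_least image_subsetI insert_subsetI empty_subsetI)
qed

lemma umbrella_D:
  assumes "c \<in> \<Union>(triangles n)"
  shows "\<exists>vs. 3 \<le> length vs \<and> {v \<in> nodes (Gamma_D n). c \<in> triangle n v} = set vs \<and> face_cycle vs"
proof -
  consider "c = Apex" | "c = Base" | k where "k \<in> {1..n}" "c = Rim k" | k where "k \<in> {1..n}" "c = Tip k"
    using assms unfolding corners by blast
  then show ?thesis
  proof cases
    case 1
    then show ?thesis using vertex_star_Apex n by (intro exI[of _ "map dv [1..<Suc n]"]) simp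
  next
    case 2
    then show ?thesis using vertex_star_Base length_base_cycle n by (intro exI[of _ base_cycle]) simp
  next
    case (3 k)
    have "prv n k \<in> {1..n}" "k = nxt n (prv n k)" using prv_mem[OF 3(1)] nxt_prv[OF 3(1)] by simp_all
    from vertex_star_Rim[OF this] show ?thesis
      unfolding 3(2) by (intro exI[of _ "[_, _, _, _, _, _]"]) simp
  next
    case (4 k)
    show ?thesis
      unfolding 4(2) using vertex_star_Tip[OF 4(1)] by (intro exI[of _ "[_, _, _]"]) simp
  qed
qed

lemma finite_nodes: "finite (nodes (Gamma_D n))"
  by (simp add: nodes_Gamma)

lemma finite_simplices_D: "finite (simplices (triangles n))"
proof -
  have "simplices (triangles n) \<subseteq> Pow (\<Union>(triangles n))" by (auto simp: simplices_def)
  then show ?thesis by (rule finite_subset) (simp add: corners)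
qed

lemma triangulation_D:
  assumes "inj_on code (simplices (triangles n))"
  shows "triangulation (triangles n) code"
proof
  show "finite (triangles n)" by (simp add: triangles_def finite_nodes)
  show "triangles n \<noteq> {}" using card_nodes_Gamma[of n] n by (auto simp: triangles_def)
  show "card t = 3" if "t \<in> triangles n" for t using that card_triangle_D by (auto simp: triangles_def)
  show "card {t \<in> triangles n. e \<subseteq> t} = 2" if "t \<in> triangles n" "e \<subseteq> t" "card e = 2" for t e
    using that edge_link card_link unfolding card_star by (auto simp: triangles_def)
  show "inj_on code (simplices (triangles n))" by fact
  show "\<exists>ts. distinct ts \<and> set ts = {t \<in> triangles n. c \<in> t} \<and> 3 \<le> length ts \<and>
      (\<forall>i < length ts. card (ts ! i \<inter> ts ! (Suc i mod length ts)) = 2)" if c: "c \<in> \<Union>(triangles n)" for c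
  proof -
    obtain vs where vs: "3 \<le> length vs" "{v \<in> nodes (Gamma_D n). c \<in> triangle n v} = set vs"
      "distinct vs" "\<forall>i < length vs. {vs ! i, vs ! (Suc i mod length vs)} \<in> links (Gamma_D n)"
      using umbrella_D[OF c] unfolding face_cycle_def by blast
    have "inj_on (triangle n) (set vs)" by (rule inj_on_subset[OF inj_triangle]) (use vs(2) in blast)
    moreover have "set (map (triangle n) vs) = {t \<in> triangles n. c \<in> t}"
      unfolding set_map vs(2)[symmetric] by (auto simp: triangles_def)
    moreover have "Suc i mod length vs < length vs" for i using vs(1) by (intro mod_less_divisor) linarith
    ultimately show ?thesis
      using vs adjacent_triangles by (intro exI[of _ "map (triangle n) vs"]) (simp add: distinct_map)
  qed
qed

lemma sphere_D:
  assumes "inj_on code (simplices (triangles n))"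
  shows "simplicial_sphere (coded_surface code (triangles n))"
proof -
  interpret triangulation "triangles n" code by (rule triangulation_D) fact
  let ?r = "{(u, v). {u, v} \<in> simplices (triangles n)}"
  have edge: "(x, y) \<in> ?r" if "v \<in> nodes (Gamma_D n)" "{x, y} \<subseteq> triangle n v" for v x y
    using that by (auto simp: simplices_def triangles_def)
  have rim: "(Apex, Rim k) \<in> ?r" if "k \<in> {1..n}" for k
    using that node_mem by (intro edge[of "dv k"]) auto
  have tip: "(Rim k, Tip k) \<in> ?r" if "k \<in> {1..n}" for k
    using that node_mem by (intro edge[of "bv k"]) auto
  have base: "(Rim 1, Base) \<in> ?r"
    using n node_mem by (intro edge[of "bv 1"]) auto
  show ?thesis
  proof (rule simplicial_sphere_X[of Apex])
    fix c assume "c \<in> \<Union>(triangles n)"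
    then consider "c = Apex" | "c = Base" | k where "k \<in> {1..n}" "c = Rim k" | k where "k \<in> {1..n}" "c = Tip k"
      unfolding corners by blast
    then show "(Apex, c) \<in> ?r\<^sup>*"
    proof cases
      case 2
      have "(Apex, Rim 1) \<in> ?r" using n by (intro rim) simp
      then show ?thesis using base 2 by (meson r_into_rtrancl rtrancl_into_rtrancl)
    next
      case (4 k)
      then show ?thesis using rim tip by (meson r_into_rtrancl rtrancl_into_rtrancl)
    qed (use rim in auto)
  next
    have "card (triangles n) = 4 * n"
      unfolding triangles_def by (simp add: card_image inj_triangle card_nodes_Gamma)
    moreover have "card ({Apex, Base} \<union> Rim ` {1..n} \<union> Tip ` {1..n}) = 2 * n + 2"
    proof -
      have "card (Rim ` {1..n} \<union> Tip ` {1..n}) = 2 * n"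
        by (subst card_Un_disjoint) (auto simp: card_image inj_on_def)
      moreover have "Apex \<notin> insert Base (Rim ` {1..n} \<union> Tip ` {1..n})" "Base \<notin> Rim ` {1..n} \<union> Tip ` {1..n}" by auto
      moreover have "finite (Rim ` {1..n} \<union> Tip ` {1..n})" by simp
      ultimately show ?thesis by (simp add: Un_assoc)
    qed
    ultimately show "card (triangles n) + 4 = 2 * card (\<Union>(triangles n))"
      by (simp add: corners)
  qed
qed

text \<open>Faces go to the nodes that they come from, and an edge goes to the set of nodes of the two faces
  containing it. As a link of \<open>\<Gamma>\<^sub>D\<close> is its own set of end nodes, only the bijectivity
  on edges has to be checked. It is injective since an edge is the intersection of its two faces.\<close>

lemma face_graph_D:
  assumes "inj_on code (simplices (triangles n))"
  shows "graph_iso (face_graph (coded_surface code (triangles n))) (Gamma_D n)"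
proof -
  interpret triangulation "triangles n" code by (rule triangulation_D) fact
  define \<theta> where "\<theta> v = code (triangle n v)" for v
  define \<phi> where "\<phi> = inv_into (nodes (Gamma_D n)) \<theta>"
  have "inj_on \<theta> (nodes (Gamma_D n))"
    unfolding \<theta>_def by (rule inj_onI) (use code_eq triangle_simplex inj_triangle in \<open>auto simp: triangles_def inj_on_def\<close>)
  then have \<theta>: "bij_betw \<theta> (nodes (Gamma_D n)) (faces X)"
    unfolding bij_betw_def by (simp add: surface_parts(3) \<theta>_def) (simp add: triangles_def image_image)
  then have \<phi>: "bij_betw \<phi> (faces X) (nodes (Gamma_D n))" unfolding \<phi>_def by (rule bij_betw_inv_into)
  define star where "star s = {v \<in> nodes (Gamma_D n). s \<subseteq> triangle n v}" for s
  define \<psi> where "\<psi> e = \<phi> ` {F \<in> faces X. e \<triangleleft>\<^bsub>X\<^esub> F}" for e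
  have \<psi>: "\<psi> (code s) = star s" if s: "s \<in> simplices (triangles n)" "card s = 2" for s
  proof -
    have "{F \<in> faces X. code s \<triangleleft>\<^bsub>X\<^esub> F} = code ` {t \<in> triangles n. s \<subset> t}"
      unfolding surface_parts(3) using triangle_simplex s(1) by (intro above) auto
    also have "\<dots> = \<theta> ` star s"
      unfolding card_above_edge(1)[OF s] star_as_image star_def by (simp add: \<theta>_def image_image)
    finally have "\<psi> (code s) = (\<lambda>v. \<phi> (\<theta> v)) ` star s" by (simp add: \<psi>_def image_image)
    also have "\<dots> = star s"
    proof -
      have "\<phi> (\<theta> v) = v" if "v \<in> star s" for v
        using that bij_betw_inv_into_left[OF \<theta>] by (simp add: \<phi>_def star_def)
      then show ?thesis by simp
    qed
    finally show ?thesis .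
  qed
  have link: "star s \<in> links (Gamma_D n)" if "s \<in> simplices (triangles n)" "card s = 2" for s
    using that edge_link unfolding star_def by (auto simp: simplices_def triangles_def)
  have "inj_on \<psi> (edges X)"
    unfolding surface_parts
  proof (rule inj_onI, elim imageE)
    fix x y s t assume eq: "\<psi> x = \<psi> y" and xy: "x = code s" "y = code t"
      and "s \<in> {s \<in> simplices (triangles n). card s = 2}" "t \<in> {s \<in> simplices (triangles n). card s = 2}"
    then have s: "s \<in> simplices (triangles n)" "card s = 2" and t: "t \<in> simplices (triangles n)" "card t = 2" by auto
    have st: "star s = star t" using eq \<psi> s t xy by simp
    obtain u v where uv: "star s = {u, v}" using card_link[OF link[OF s]] by (auto simp: card_2_iff)
    then have "card (triangle n u \<inter> triangle n v) = 2" using adjacent_triangles link[OF s] by simp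
    moreover have "s \<subseteq> triangle n u \<inter> triangle n v" using uv unfolding star_def by blast
    moreover have "t \<subseteq> triangle n u \<inter> triangle n v" using uv[unfolded st] unfolding star_def by blast
    ultimately have "s = triangle n u \<inter> triangle n v" "t = triangle n u \<inter> triangle n v"
      using s(2) t(2) by (metis card.infinite card_subset_eq zero_neq_numeral)+
    then show "x = y" using xy by simp
  qed
  moreover have "\<psi> ` edges X = links (Gamma_D n)"
  proof (intro subset_antisym subsetI)
    fix l assume "l \<in> \<psi> ` edges X"
    then show "l \<in> links (Gamma_D n)" using \<psi> link by (auto simp: surface_parts)
  next
    fix l assume l: "l \<in> links (Gamma_D n)"
    obtain e where e: "card e = 2" "star e = l" using link_edge[OF l] unfolding star_def by blast
    have "l \<noteq> {}" using card_link[OF l] by auto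
    then obtain v where "v \<in> nodes (Gamma_D n)" "e \<subseteq> triangle n v" using e(2) unfolding star_def by blast
    moreover have "e \<noteq> {}" using e(1) by auto
    ultimately have "e \<in> simplices (triangles n)" by (auto simp: simplices_def triangles_def)
    then show "l \<in> \<psi> ` edges X" using \<psi> e by (auto simp: surface_parts intro!: image_eqI[of _ _ "code e"])
  qed
  ultimately have "bij_betw \<psi> (edges X) (links (Gamma_D n))" by (simp add: bij_betw_def)
  then show ?thesis
    unfolding graph_iso_def using \<phi> by (intro exI[of _ \<phi>] exI[of _ \<psi>]) (simp add: face_graph_def \<psi>_def)
qed

end

section \<open>The automorphism group\<close>

text \<open>The representative of \<open>z\<close> modulo \<open>n\<close> in the index set \<open>{1..n}\<close>. Integer indices are convenient for
  rotations and reflections.\<close>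

definition idx :: "nat \<Rightarrow> int \<Rightarrow> nat" where
  "idx n z = nat ((z - 1) mod int n) + 1"

lemma idx_mem: "n > 0 \<Longrightarrow> idx n z \<in> {1..n}"
  by (auto simp: idx_def Suc_le_eq nat_less_iff)

lemma idx_int: "k \<in> {1..n} \<Longrightarrow> idx n (int k) = k"
  by (auto simp: idx_def)

lemma idx_eq_iff: "n > 0 \<Longrightarrow> idx n z = idx n w \<longleftrightarrow> int n dvd z - w"
  by (simp add: idx_def nat_eq_iff flip: mod_eq_dvd_iff) (simp add: mod_eq_dvd_iff)

lemma dvd_int_idx: "n > 0 \<Longrightarrow> int n dvd int (idx n z) - z"
  using idx_eq_iff[of n "int (idx n z)" z] idx_int[OF idx_mem] by simp

lemma nxt_idx: "n > 0 \<Longrightarrow> nxt n (idx n z) = idx n (z + 1)"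
proof -
  assume n: "n > 0"
  have "nxt n k = idx n (int k + 1)" if "k \<in> {1..n}" for k
    using that idx_int[of "k + 1" n] n by (auto simp: nxt_def idx_def algebra_simps)
  then have "nxt n (idx n z) = idx n (int (idx n z) + 1)" using idx_mem[OF n] by blast
  also have "\<dots> = idx n (z + 1)" using dvd_int_idx[OF n, of z] by (simp add: idx_eq_iff[OF n])
  finally show ?thesis .
qed

text \<open>The dihedral group acts on the rim by \<open>k \<mapsto> i + k\<close> and \<open>k \<mapsto> i - k\<close>. A reflection maps the
  edge from \<open>Rim k\<close> to \<open>Rim (k + 1)\<close>, and with it \<open>Tip k\<close>, to the one from \<open>Rim (i - k - 1)\<close> to
  \<open>Rim (i - k)\<close>; hence the shift by one for tips.\<close>

fun act :: "nat \<Rightarrow> int \<times> bool \<Rightarrow> corner \<Rightarrow> corner" where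
  "act n z Apex = Apex"
| "act n z Base = Base"
| "act n (i, s) (Rim k) = Rim (idx n (if s then i - int k else i + int k))"
| "act n (i, s) (Tip k) = Tip (idx n (if s then i - int k - 1 else i + int k))"

(* Indices are kept in the form "idx n z", on which the action is computed by act_Rim and act_Tip below. *)
declare act.simps(3,4) [simp del]

context
  fixes n :: nat
  assumes n: "n > 3"
begin

lemma n_pos: "n > 0" and n2: "n > 2" using n by simp_all

lemmas corner_set = corners[OF n2]

lemma act_Rim: "act n (i, s) (Rim (idx n z)) = Rim (idx n (if s then i - z else i + z))"
  and act_Tip: "act n (i, s) (Tip (idx n z)) = Tip (idx n (if s then i - z - 1 else i + z))"
proof -
  have "int n dvd int (idx n z) - z" by (rule dvd_int_idx[OF n_pos])
  then have "int n dvd z - int (idx n z)" using dvd_minus_iff[of "int n" "int (idx n z) - z"] by simp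
  then show "act n (i, s) (Rim (idx n z)) = Rim (idx n (if s then i - z else i + z))"
    "act n (i, s) (Tip (idx n z)) = Tip (idx n (if s then i - z - 1 else i + z))"
    using dvd_int_idx[OF n_pos, of z] by (simp_all add: act.simps idx_eq_iff[OF n_pos])
qed

lemma corner_cases [consumes 1, case_names Apex Base Rim Tip]:
  assumes "c \<in> \<Union>(triangles n)"
  obtains "c = Apex" | "c = Base" | z where "c = Rim (idx n z)" | z where "c = Tip (idx n z)"
  using assms idx_int unfolding corner_set by (metis (no_types, lifting) UnE imageE insertE singletonD)

lemma triangle_idx:
  "triangle n (av (idx n z)) = {Tip (idx n z), Rim (idx n (z + 1)), Base}"
  "triangle n (bv (idx n z)) = {Tip (idx n z), Rim (idx n z), Base}"
  "triangle n (cv (idx n z)) = {Tip (idx n z), Rim (idx n z), Rim (idx n (z + 1))}"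
  "triangle n (dv (idx n z)) = {Apex, Rim (idx n z), Rim (idx n (z + 1))}"
  by (simp_all add: nxt_idx[OF n_pos])

lemma triangles_idx:
  "triangles n = (\<Union>z. {triangle n (av (idx n z)), triangle n (bv (idx n z)),
     triangle n (cv (idx n z)), triangle n (dv (idx n z))})"
proof -
  have "{1..n} = range (idx n)" using idx_int idx_mem[OF n_pos] by (metis image_subset_iff rangeI subsetI subset_antisym)
  then show ?thesis unfolding triangles_def nodes_Gamma by (simp only: image_Un image_image) blast
qed

lemma triangles_idx_mem:
  "triangle n (av (idx n z)) \<in> triangles n" "triangle n (bv (idx n z)) \<in> triangles n"
  "triangle n (cv (idx n z)) \<in> triangles n" "triangle n (dv (idx n z)) \<in> triangles n"
  unfolding triangles_idx by blast+

lemma act_triangles: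
  assumes "t \<in> triangles n"
  shows "act n (i, s) ` t \<in> triangles n"
proof -
  obtain z where "t = triangle n (av (idx n z)) \<or> t = triangle n (bv (idx n z)) \<or>
      t = triangle n (cv (idx n z)) \<or> t = triangle n (dv (idx n z))"
    using assms unfolding triangles_idx by blast
  moreover have "i - (z + 1) = i - z - 1" "i - z = (i - z - 1) + 1" "i + (z + 1) = (i + z) + 1" by simp_all
  moreover have
    "act n (i, s) ` triangle n (av (idx n z)) =
       (if s then triangle n (bv (idx n (i - z - 1))) else triangle n (av (idx n (i + z))))"
    "act n (i, s) ` triangle n (bv (idx n z)) =
       (if s then triangle n (av (idx n (i - z - 1))) else triangle n (bv (idx n (i + z))))"
    "act n (i, s) ` triangle n (cv (idx n z)) =
       (if s then triangle n (cv (idx n (i - z - 1))) else triangle n (cv (idx n (i + z))))"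
    "act n (i, s) ` triangle n (dv (idx n z)) =
       (if s then triangle n (dv (idx n (i - z - 1))) else triangle n (dv (idx n (i + z))))"
    unfolding triangle_idx by (auto simp: act_Rim act_Tip algebra_simps)
  ultimately show ?thesis using triangles_idx_mem by presburger
qed

lemma act_mult:
  assumes "c \<in> \<Union>(triangles n)"
  shows "act n (x \<otimes>\<^bsub>dihedral_group n\<^esub> y) c = act n x (act n y c)"
proof -
  obtain i s j t where xy: "x = (i, s)" "y = (j, t)" by fastforce
  have dvd: "int n dvd (w mod int n + u) - (w + u)" "int n dvd (w mod int n - u) - (w - u)"
    "int n dvd (w mod int n - u - 1) - (w - u - 1)" for w u
    by (simp_all add: mod_eq_dvd_iff[symmetric])
  have "idx n (w mod int n + u) = idx n (w + u)" "idx n (w mod int n - u) = idx n (w - u)"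
    "idx n (w mod int n - u - 1) = idx n (w - u - 1)" for w u
    using dvd by (simp_all add: idx_eq_iff[OF n_pos])
  then show ?thesis
    unfolding xy
    by (cases rule: corner_cases[OF assms]) (auto simp: dihedral_group_def act_Rim act_Tip algebra_simps)
qed

lemma act_one: "c \<in> \<Union>(triangles n) \<Longrightarrow> act n (0, False) c = c"
  by (erule corner_cases) (simp_all add: act_Rim act_Tip)

lemma inj_act: "inj_on (act n x) (\<Union>(triangles n))"
proof -
  obtain i s where x: "x = (i, s)" by fastforce
  define y where "y = (if s then (i mod int n, True) else (- i mod int n, False))"
  have "y \<otimes>\<^bsub>dihedral_group n\<^esub> x = (0, False)"
    by (auto simp: x y_def dihedral_group_def mod_simps)
  then have "act n y (act n x c) = c" if "c \<in> \<Union>(triangles n)" for c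
    using act_mult[OF that, of y x] act_one[OF that] by simp
  then show ?thesis by (rule inj_on_inverseI)
qed

lemma act_faithful:
  assumes x: "x \<in> carrier (dihedral_group n)" and y: "y \<in> carrier (dihedral_group n)"
    and eq: "\<And>c. c \<in> \<Union>(triangles n) \<Longrightarrow> act n x c = act n y c"
  shows "x = y"
proof -
  obtain i s j t where xy: "x = (i, s)" "y = (j, t)" by fastforce
  have ij: "0 \<le> i" "i < int n" "0 \<le> j" "j < int n" using x y by (auto simp: xy dihedral_group_def)
  have rim: "Rim (idx n z) \<in> \<Union>(triangles n)" for z using idx_mem[OF n_pos] unfolding corner_set by blast
  have 0: "int n dvd i - j"
    using eq[OF rim[of 0]] by (simp add: xy act_Rim idx_eq_iff[OF n_pos] split: if_splits)
  then have "i = j" using ij zdvd_not_zless[of "i - j" "int n"] zdvd_not_zless[of "j - i" "int n"]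
    by (metis abs_of_nonneg cancel_comm_monoid_add_class.diff_cancel diff_ge_0_iff_ge dvd_diff_commute le_less_linear mod_eq_dvd_iff mod_pos_pos_trivial)
  moreover have "s = t"
  proof (rule ccontr)
    assume "s \<noteq> t"
    then have "int n dvd 2 \<or> int n dvd - 2"
      using eq[OF rim[of 1]] \<open>i = j\<close> by (auto simp: xy act_Rim idx_eq_iff[OF n_pos] split: if_splits)
    then have "int n dvd 2" by auto
    then show False using n zdvd_imp_le[of "int n" 2] by simp
  qed
  ultimately show ?thesis by (simp add: xy)
qed

lemma Apex_triangle: "t \<in> triangles n \<Longrightarrow> Apex \<in> t \<Longrightarrow> \<exists>z. t = {Apex, Rim (idx n z), Rim (idx n (z + 1))}"
  unfolding triangles_idx triangle_idx by auto

lemma Rim_Rim_Tip_triangle: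
  assumes "{Rim a, Rim b, Tip j} \<in> triangles n" "a \<noteq> b"
  shows "(a = j \<and> b = nxt n j) \<or> (b = j \<and> a = nxt n j)" "j \<in> {1..n}"
proof -
  obtain v where v: "v \<in> nodes (Gamma_D n)" "{Rim a, Rim b, Tip j} = triangle n v"
    using assms(1) by (auto simp: triangles_def)
  have m: "Rim a \<in> triangle n v" "Rim b \<in> triangle n v" "Tip j \<in> triangle n v" by (simp_all flip: v(2))
  from v(1) m show "(a = j \<and> b = nxt n j) \<or> (b = j \<and> a = nxt n j)"
    by (cases rule: node_cases) (use assms(2) in auto)
  from v(1) m show "j \<in> {1..n}"
    by (cases rule: node_cases) auto
qed

text \<open>Tips have degree 3, while the degrees of \<open>Apex\<close>, \<open>Base\<close> and the rim are \<open>n\<close>, \<open>2n\<close> and 6. This is where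
  \<open>n > 3\<close> enters: for \<open>n = 3\<close> the apex looks like a tip.\<close>

lemma degree_3_iff_Tip:
  assumes "c \<in> \<Union>(triangles n)"
  shows "card {t \<in> triangles n. c \<in> t} = 3 \<longleftrightarrow> (\<exists>k. c = Tip k)"
proof -
  have deg: "card {t \<in> triangles n. c \<in> t} = length vs"
    if "{v \<in> nodes (Gamma_D n). c \<in> triangle n v} = set vs" "face_cycle n vs" for vs
    using card_star[OF n2, of "{c}"] that distinct_card[of vs] by (simp add: face_cycle_def[OF n2])
  consider "c = Apex" | "c = Base" | k where "k \<in> {1..n}" "c = Rim k" | k where "k \<in> {1..n}" "c = Tip k"
    using assms unfolding corner_set by blast
  then show ?thesis
  proof cases
    case 1
    then show ?thesis using deg[of "map dv [1..<Suc n]"] vertex_star_Apex[OF n2] n by simp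
  next
    case 2
    then show ?thesis using deg[of "base_cycle n"] vertex_star_Base[OF n2] length_base_cycle[OF n2] n by simp
  next
    case (3 k)
    have "prv n k \<in> {1..n}" "k = nxt n (prv n k)" using prv_mem[OF 3(1)] nxt_prv[OF 3(1)] by simp_all
    from vertex_star_Rim[OF n2 this] show ?thesis
      using deg[of "[_, _, _, _, _, _]"] unfolding 3(2) by simp
  next
    case (4 k)
    then show ?thesis using deg[of "[_, _, _]"] vertex_star_Tip[OF n2 4(1)] by simp
  qed
qed

text \<open>Every automorphism is a rotation or a reflection. It preserves degrees and so permutes the tips.
  Among the remaining corners only \<open>Apex\<close> shares no triangle with a tip, so \<open>Apex\<close> is fixed; of the
  others only \<open>Base\<close> shares no triangle with \<open>Apex\<close>, so \<open>Base\<close> is fixed as well. Hence the rim is permuted, and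
  the triangles at \<open>Apex\<close> show that neighbours on the rim stay neighbours. An
  injective map of an \<open>n\<close>-cycle that preserves adjacency never turns back, so it is \<open>k \<mapsto> c + k\<close>
  or \<open>k \<mapsto> c - k\<close>. The tips follow the rim since \<open>Tip k\<close> is the only tip
  in a triangle with \<open>Rim k\<close> and \<open>Rim (k + 1)\<close>.\<close>

lemma rigidity:
  assumes inj: "inj_on g (\<Union>(triangles n))" and tri: "\<And>t. t \<in> triangles n \<Longrightarrow> g ` t \<in> triangles n"
  shows "\<exists>x \<in> carrier (dihedral_group n). \<forall>c \<in> \<Union>(triangles n). g c = act n x c"
proof -
  let ?V = "\<Union>(triangles n)"
  have V: "g c \<in> ?V" if "c \<in> ?V" for c using that tri by blast
  have g_eq: "g c = g d \<longleftrightarrow> c = d" if "c \<in> ?V" "d \<in> ?V" for c d using inj that by (auto dest: inj_onD)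
  have corner: "Apex \<in> ?V" "Base \<in> ?V" "Rim (idx n z) \<in> ?V" "Tip (idx n z) \<in> ?V" for z
    using idx_mem[OF n_pos] unfolding corner_set by blast+
  have inj_T: "inj_on ((`) g) (triangles n)"
    using inj_on_image_eq_iff[OF inj] by (intro inj_onI) blast
  have "finite (triangles n)" by (simp add: triangles_def nodes_Gamma)
  then have perm: "(`) g ` triangles n = triangles n" using inj_T tri by (intro endo_inj_surj) auto
  have surj: "\<exists>t'. t' \<in> triangles n \<and> t = g ` t'" if "t \<in> triangles n" for t using perm that by blast
  have mem: "g c \<in> g ` t \<longleftrightarrow> c \<in> t" if "c \<in> ?V" "t \<in> triangles n" for c t
    using inj_on_image_mem_iff[OF inj that(1)] that(2) by blast
  have Tip: "(\<exists>k. g c = Tip k) \<longleftrightarrow> (\<exists>k. c = Tip k)" if c: "c \<in> ?V" for c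
  proof -
    have "{t \<in> triangles n. g c \<in> t} = (`) g ` {t \<in> triangles n. c \<in> t}"
    proof -
      have "{t \<in> triangles n. g c \<in> t} = {t \<in> (`) g ` triangles n. g c \<in> t}" using perm by simp
      also have "\<dots> = (`) g ` {t \<in> triangles n. g c \<in> g ` t}" by blast
      also have "{t \<in> triangles n. g c \<in> g ` t} = {t \<in> triangles n. c \<in> t}" using mem[OF c] by blast
      finally show ?thesis .
    qed
    then have "card {t \<in> triangles n. g c \<in> t} = card {t \<in> triangles n. c \<in> t}"
      using inj_on_subset[OF inj_T] by (simp add: card_image)
    then show ?thesis using degree_3_iff_Tip c V by metis
  qed
  \<comment> \<open>\<open>Apex\<close> shares no triangle with a tip, whereas \<open>Base\<close> and the rim do.\<close>
  have Apex: "g Apex = Apex"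
  proof (rule ccontr)
    assume ne: "g Apex \<noteq> Apex"
    have "\<exists>t z. t \<in> triangles n \<and> g Apex \<in> t \<and> Tip (idx n z) \<in> t"
      using V[OF corner(1)]
    proof (cases rule: corner_cases)
      case Base
      then show ?thesis using triangles_idx_mem(2)[of 0] unfolding triangle_idx by blast
    next
      case (Rim z)
      then show ?thesis using triangles_idx_mem(2)[of z] unfolding triangle_idx by blast
    qed (use ne Tip[OF corner(1)] in auto)
    then obtain t z where t: "t \<in> triangles n" "g Apex \<in> t" "Tip (idx n z) \<in> t" by blast
    obtain t' where t': "t' \<in> triangles n" "t = g ` t'" using surj t(1) by blast
    then have "Apex \<in> t'" using t(2) mem corner by blast
    then obtain y where y: "t' = {Apex, Rim (idx n y), Rim (idx n (y + 1))}" using Apex_triangle t'(1) by blast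
    obtain c where "c \<in> t'" "g c = Tip (idx n z)" using t(3) t'(2) by force
    then show False using Tip[of c] y corner by auto
  qed
  have Base: "g Base = Base"
    using V[OF corner(2)]
  proof (cases rule: corner_cases)
    case Apex
    then show ?thesis using g_eq[OF corner(2,1)] \<open>g Apex = Apex\<close> by simp
  next
    case (Rim z)
    obtain t' where t': "t' \<in> triangles n" "triangle n (dv (idx n z)) = g ` t'" using surj triangles_idx_mem(4) by blast
    then have "g Apex \<in> g ` t'" "g Base \<in> g ` t'" using Rim \<open>g Apex = Apex\<close> by (auto simp: triangle_idx simp flip: t'(2))
    then have "Apex \<in> t'" "Base \<in> t'" using mem t'(1) corner by blast+
    then show ?thesis using Apex_triangle[OF t'(1)] by auto
  next
    case (Tip z)
    then show ?thesis using \<open>\<And>c. c \<in> ?V \<Longrightarrow> (\<exists>k. g c = Tip k) \<longleftrightarrow> (\<exists>k. c = Tip k)\<close>[OF corner(2)] by auto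
  qed
  have Rim: "\<exists>k. k \<in> {1..n} \<and> g (Rim (idx n z)) = Rim k" for z
    using V[OF corner(3)[of z]]
  proof (cases rule: corner_cases)
    case Apex
    then show ?thesis using g_eq[OF corner(3,1), of z] \<open>g Apex = Apex\<close> by simp
  next
    case Base
    then show ?thesis using g_eq[OF corner(3,2), of z] \<open>g Base = Base\<close> by simp
  next
    case (Rim w)
    then show ?thesis using idx_mem[OF n_pos] by blast
  next
    case (Tip w)
    then show ?thesis using \<open>\<And>c. c \<in> ?V \<Longrightarrow> (\<exists>k. g c = Tip k) \<longleftrightarrow> (\<exists>k. c = Tip k)\<close>[OF corner(3)[of z]] by auto
  qed
  then obtain h where h: "h z \<in> {1..n}" "g (Rim (idx n z)) = Rim (h z)" for z by metis
  have h_eq: "h z = h w \<longleftrightarrow> int n dvd z - w" for z w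
    using g_eq[OF corner(3,3), of z w] by (simp add: h idx_eq_iff[OF n_pos])
  have step: "h (z + 1) = nxt n (h z) \<or> h z = nxt n (h (z + 1))" for z
  proof -
    have "g ` triangle n (dv (idx n z)) = {Apex, Rim (h z), Rim (h (z + 1))}"
      unfolding triangle_idx by (simp add: Apex h)
    then have "{Apex, Rim (h z), Rim (h (z + 1))} \<in> triangles n" using tri[OF triangles_idx_mem(4)] by metis
    then obtain y where "{Apex, Rim (h z), Rim (h (z + 1))} = {Apex, Rim (idx n y), Rim (nxt n (idx n y))}"
      using Apex_triangle unfolding nxt_idx[OF n_pos] by blast
    then have "{Rim (h z), Rim (h (z + 1))} = {Rim (idx n y), Rim (nxt n (idx n y))}"
      by (auto simp: insert_eq_iff)
    then show ?thesis by (auto simp: doubleton_eq_iff)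
  qed
  have no_return: "h (z + 1 + 1) \<noteq> h z" for z
  proof
    assume "h (z + 1 + 1) = h z"
    then have "int n dvd 2" by (simp add: h_eq)
    then show False using n zdvd_imp_le[of "int n" 2] by simp
  qed
  \<comment> \<open>The first step decides the orientation of all further steps.\<close>
  have straight: "h (int m + 1) = nxt n (h (int m))" if "h 1 = nxt n (h 0)" for m
  proof (induction m)
    case (Suc m)
    then show ?case
      using step[of "int m + 1"] no_return[of "int m"] h(1) nxt_inject by (metis of_nat_Suc add.commute)
  qed (use that in simp)
  have turned: "h (int m) = nxt n (h (int m + 1))" if "h 0 = nxt n (h 1)" for m
  proof (induction m)
    case (Suc m)
    then show ?case
      using step[of "int m + 1"] no_return[of "int m"] by (metis of_nat_Suc add.commute)
  qed (use that in simp)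
  define c where "c = int (h 0)"
  have c: "h 0 = idx n c" using h(1) by (simp add: c_def idx_int)
  have "\<exists>s. \<forall>m. h (int m) = idx n (if s then c - int m else c + int m)"
    using step[of 0]
  proof
    assume "h (0 + 1) = nxt n (h 0)"
    then have *: "h (int m + 1) = nxt n (h (int m))" for m using straight by simp
    have "h (int m) = idx n (c + int m)" for m
    proof (induction m)
      case (Suc m)
      then show ?case using *[of m] by (simp add: nxt_idx[OF n_pos] algebra_simps)
    qed (simp add: c)
    then show ?thesis by (intro exI[of _ False]) simp
  next
    assume "h 0 = nxt n (h (0 + 1))"
    then have *: "h (int m) = nxt n (h (int m + 1))" for m using turned by simp
    have "h (int m) = idx n (c - int m)" for m
    proof (induction m)
      case (Suc m)
      have "nxt n (h (int (Suc m))) = nxt n (idx n (c - int (Suc m)))"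
        using Suc *[of m] by (simp add: nxt_idx[OF n_pos] algebra_simps)
      then show ?case using nxt_inject h(1) idx_mem[OF n_pos] by metis
    qed (simp add: c)
    then show ?thesis by (intro exI[of _ True]) simp
  qed
  then obtain s where s: "h (int m) = idx n (if s then c - int m else c + int m)" for m by blast
  \<comment> \<open>The elements of the dihedral group have their rotation part reduced modulo \<open>n\<close>.\<close>
  define x where "x = (c mod int n, s)"
  have x: "x \<in> carrier (dihedral_group n)" using n by (simp add: x_def dihedral_group_def)
  have gRim: "g (Rim k) = act n x (Rim k)" if "k \<in> {1..n}" for k
  proof -
    have "g (Rim k) = Rim (h (int k))" using h(2)[of "int k"] that by (simp add: idx_int)
    moreover have "int n dvd c - c mod int n" by (simp add: dvd_minus_mod)
    ultimately show ?thesis by (simp add: x_def s act.simps idx_eq_iff[OF n_pos])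
  qed
  have gTip: "g (Tip k) = act n x (Tip k)" if k: "k \<in> {1..n}" for k
  proof -
    have kV: "Tip k \<in> ?V" using k unfolding corner_set by blast
    have nk: "nxt n k \<in> {1..n}" "k \<noteq> nxt n k" using nxt_mem[OF k] nxt_neq[OF _ k] n by auto
    have t: "triangle n (cv k) \<in> triangles n" unfolding triangles_def by (rule imageI) (use k node_mem in blast)
    obtain j where j: "g (Tip k) = Tip j" using Tip[OF kV] by blast
    obtain j' where j': "act n x (Tip k) = Tip j'" by (cases x) (auto simp: act.simps)
    obtain a b where ab: "g (Rim k) = Rim a" "g (Rim (nxt n k)) = Rim b"
      using Rim[of "int k"] Rim[of "int (nxt n k)"] idx_int[OF k] idx_int[OF nk(1)] by auto
    have "Rim k \<in> ?V" "Rim (nxt n k) \<in> ?V" using k nk unfolding corner_set by blast+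
    then have "a \<noteq> b" using g_eq[of "Rim k" "Rim (nxt n k)"] nk ab by auto
    have "g ` triangle n (cv k) = {Rim a, Rim b, Tip j}" by (auto simp: ab j)
    then have 1: "{Rim a, Rim b, Tip j} \<in> triangles n" using tri[OF t] by simp
    have "act n x ` triangle n (cv k) = {Rim a, Rim b, Tip j'}"
      using gRim[OF k] gRim[OF nk(1)] by (auto simp: ab j')
    then have 2: "{Rim a, Rim b, Tip j'} \<in> triangles n" using act_triangles[OF t] by (metis surj_pair)
    show ?thesis
      using Rim_Rim_Tip_triangle[OF 1 \<open>a \<noteq> b\<close>] Rim_Rim_Tip_triangle[OF 2 \<open>a \<noteq> b\<close>]
        nxt_nxt_neq[OF n2] unfolding j j' by metis
  qed
  have "g d = act n x d" if "d \<in> ?V" for d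
    using that gRim gTip unfolding corner_set by (auto simp: Apex Base)
  then show ?thesis using x by blast
qed

end

lemma iso_inv_into:
  assumes h: "h \<in> iso G H" and closed: "\<And>x y. \<lbrakk>x \<in> carrier G; y \<in> carrier G\<rbrakk> \<Longrightarrow> x \<otimes>\<^bsub>G\<^esub> y \<in> carrier G"
  shows "inv_into (carrier G) h \<in> iso H G"
proof -
  have bij: "bij_betw h (carrier G) (carrier H)" using h by (simp add: iso_def)
  let ?i = "inv_into (carrier G) h"
  have "?i (x \<otimes>\<^bsub>H\<^esub> y) = ?i x \<otimes>\<^bsub>G\<^esub> ?i y" if "x \<in> carrier H" "y \<in> carrier H" for x y
  proof -
    have i: "?i x \<in> carrier G" "?i y \<in> carrier G" using that bij_betw_apply[OF bij_betw_inv_into[OF bij]] by auto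
    have "h (?i x \<otimes>\<^bsub>G\<^esub> ?i y) = h (?i x) \<otimes>\<^bsub>H\<^esub> h (?i y)" using h i by (simp add: iso_def hom_def)
    also have "\<dots> = x \<otimes>\<^bsub>H\<^esub> y" using that bij_betw_inv_into_right[OF bij] by simp
    finally show ?thesis using closed[OF i] bij_betw_inv_into_left[OF bij] by metis
  qed
  then show ?thesis
    using bij_betw_inv_into[OF bij] by (auto simp: iso_def hom_def bij_betw_apply)
qed

lemma Aut_D:
  assumes n: "n > 3" and inj: "inj_on code (simplices (triangles n))"
  shows "Aut (coded_surface code (triangles n)) \<cong> dihedral_group n"
proof -
  interpret triangulation "triangles n" code
    using n by (intro triangulation_D inj) simp
  define h where "h x = induced code (triangles n) (act n x)" for x
  have act: "inj_on (act n x) (\<Union>(triangles n))" "\<And>t. t \<in> triangles n \<Longrightarrow> act n x ` t \<in> triangles n" for x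
    using inj_act[OF n] act_triangles[OF n] by (cases x, blast)+
  have closed: "x \<otimes>\<^bsub>dihedral_group n\<^esub> y \<in> carrier (dihedral_group n)"
    if "x \<in> carrier (dihedral_group n)" "y \<in> carrier (dihedral_group n)" for x y
    using that n by (auto simp: dihedral_group_def)
  have "h x \<in> carrier (Aut X)" for x unfolding h_def by (intro induced_in_Aut act)
  moreover have "h (x \<otimes>\<^bsub>dihedral_group n\<^esub> y) = h x \<otimes>\<^bsub>Aut X\<^esub> h y" for x y
  proof -
    have "h x \<otimes>\<^bsub>Aut X\<^esub> h y = induced code (triangles n) (act n x \<circ> act n y)"
      unfolding h_def by (intro mult_induced act)
    also have "\<dots> = h (x \<otimes>\<^bsub>dihedral_group n\<^esub> y)"
    proof -
      have "(act n x \<circ> act n y) ` t \<in> triangles n" if "t \<in> triangles n" for t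
        using act(2)[OF act(2)[OF that]] by (simp add: image_comp)
      then show ?thesis
        unfolding h_def using act(2) act_mult[OF n] by (subst induced_eq_iff) auto
    qed
    finally show ?thesis by simp
  qed
  moreover have "bij_betw h (carrier (dihedral_group n)) (carrier (Aut X))"
    unfolding bij_betw_def
  proof (intro conjI subset_antisym subsetI)
    show "inj_on h (carrier (dihedral_group n))"
    proof (rule inj_onI)
      fix x y assume xy: "x \<in> carrier (dihedral_group n)" "y \<in> carrier (dihedral_group n)" and "h x = h y"
      then have "\<forall>c \<in> \<Union>(triangles n). act n x c = act n y c"
        using induced_eq_iff[of "act n x" "act n y", OF act(2) act(2)] unfolding h_def by blast
      then show "x = y" by (intro act_faithful[OF n xy]) (rule bspec)
    qed
    show "\<pi> \<in> h ` carrier (dihedral_group n)" if \<pi>: "\<pi> \<in> carrier (Aut X)" for \<pi>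
    proof -
      obtain g where g: "inj_on g (\<Union>(triangles n))" "\<And>t. t \<in> triangles n \<Longrightarrow> g ` t \<in> triangles n"
        "\<pi> = induced code (triangles n) g" using Aut_induced[OF \<pi>] by blast
      obtain x where x: "x \<in> carrier (dihedral_group n)" "\<forall>c \<in> \<Union>(triangles n). g c = act n x c"
        using rigidity[OF n g(1,2)] by blast
      then have "\<pi> = h x" unfolding h_def g(3) using induced_eq_iff[OF g(2) act(2)] by blast
      then show ?thesis using x by blast
    qed
  qed (use \<open>\<And>x. h x \<in> carrier (Aut X)\<close> in blast)
  ultimately have "h \<in> iso (dihedral_group n) (Aut X)" by (simp add: iso_def hom_def)
  from iso_inv_into[OF this closed] show ?thesis by (auto simp: is_iso_def)
qed

section \<open>Conclusion\<close>

theorem theorem7p4: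
  fixes n :: nat
  assumes "n > 3"
  shows "(\<exists>X :: nat surface. simplicial_sphere X \<and> vertex_faithful X \<and>
            graph_iso (face_graph X) (Gamma_D n) \<and> Aut X \<cong> dihedral_group n) \<and>
         graph (Gamma_D n) \<and> k_connected 3 (Gamma_D n) \<and> planar (Gamma_D n) \<and> cubic (Gamma_D n)"
proof (intro conjI)
  have n: "n > 2" "n > 1" using assms by simp_all
  obtain code :: "corner set \<Rightarrow> nat" where code: "inj_on code (simplices (triangles n))"
    using finite_imp_inj_to_nat_seg[OF finite_simplices_D[OF n(1)]] by blast
  interpret triangulation "triangles n" code by (rule triangulation_D[OF n(1) code])
  show "\<exists>X :: nat surface. simplicial_sphere X \<and> vertex_faithful X \<and>
      graph_iso (face_graph X) (Gamma_D n) \<and> Aut X \<cong> dihedral_group n"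
    using sphere_D[OF n(1) code] vertex_faithful_X face_graph_D[OF n(1) code] Aut_D[OF assms code] by blast
  show "graph (Gamma_D n)" by (rule graph_Gamma[OF n(2)])
  show "k_connected 3 (Gamma_D n)" by (rule k_connected_Gamma[OF n(1)])
  show "planar (Gamma_D n)" by (rule planar_Gamma[OF n(1)])
  show "cubic (Gamma_D n)" by (rule cubic_Gamma[OF n(1)])
qed

end
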